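(* Let $n\ge 1$ and let $G\subseteq\binom{[n]}{2}$ be a simple loopless graph on the vertex set $[n]=\{1,\dots,n\}$ (edges written $ij$ with $i<j$). Let $$\mathsf{Shi}(G)=\{x_i-x_j=0: 1\le i<j\le n\}\cup\{x_i-x_j=1: ij\in G\},\qquad \mathsf{Ish}(G)=\{x_i-x_j=0: 1\le i<j\le n\}\cup\{x_1-x_j=i: ij\in G\}$$ be hyperplane arrangements in $\mathbb{R}^n$. Then their characteristic polynomials coincide and are given by $$\chi_{\mathsf{Shi}(G)}(p)=\chi_{\mathsf{Ish}(G)}(p)=p\sum_{k=0}^{n-1}(-1)^k\,\mathsf{Stir}(G,n-k)\,\prod_{m=k+1}^{n-1}(p-m),$$ where the product $\prod_{m=k+1}^{n-1}(p-m)=(p-k-1)(p-k-2)\cdots(p-n+1)$ (written $\frac{(p-k-1)!}{(p-n)!}$ in the paper) is interpreted as $1$ when $k=n-1$.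
   Context: For a partition $\pi$ of $[n]$, its arcs are the pairs $i<j$ such that $i,j$ lie in the same block of $\pi$ and no $\ell$ with $i<\ell<j$ lies in that block. A $G$-partition is a partition of $[n]$ all of whose arcs are edges of $G$. The $G$-Stirling number $\mathsf{Stir}(G,k)$ is the number of $G$-partitions of $[n]$ with exactly $k$ blocks. For a finite arrangement $\mathcal{A}$ of affine hyperplanes in $\mathbb{R}^n$, let $\mathfrak{L}(\mathcal{A})$ be the set of all nonempty intersections of subsets of $\mathcal{A}$ (including $\mathbb{R}^n$ as the empty intersection), ordered by reverse inclusion, with Möbius function $\mu$; the characteristic polynomial is $\chi_{\mathcal{A}}(p)=\sum_{X\in\mathfrak{L}(\mathcal{A})}\mu(\mathbb{R}^n,X)\,p^{\dim X}$. *)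

theory Defs
  imports "HOL-Analysis.Analysis" "HOL-Library.Disjoint_Sets"
    "HOL-Computational_Algebra.Polynomial"
begin

definition arcs :: "nat set set \<Rightarrow> (nat \<times> nat) set" where
  "arcs P = {(i, j). i < j \<and> (\<exists>B\<in>P. i \<in> B \<and> j \<in> B \<and> \<not> (\<exists>l\<in>B. i < l \<and> l < j))}"

definition G_partition :: "nat \<Rightarrow> nat set set \<Rightarrow> nat set set \<Rightarrow> bool" where
  "G_partition n G P \<longleftrightarrow> partition_on {1..n} P \<and> (\<forall>(i, j)\<in>arcs P. {i, j} \<in> G)"

definition Stir :: "nat \<Rightarrow> nat set set \<Rightarrow> nat \<Rightarrow> nat" where
  "Stir n G k = card {P. G_partition n G P \<and> card P = k}"

text \<open>The empty intersection is the whole space, since \<^term>\<open>\<Inter>{} = UNIV\<close>.\<close>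

definition intersection_poset :: "'a set set \<Rightarrow> 'a set set" where
  "intersection_poset A = {\<Inter>B | B. B \<subseteq> A \<and> \<Inter>B \<noteq> {}}"

text \<open>The Moebius function of a finite family \<open>P\<close> of sets ordered by reverse inclusion, so that
  \<open>X\<close> lies below \<open>Y\<close> iff \<open>Y \<subseteq> X\<close>. It is given by the usual recursion \<open>\<mu>(X, X) = 1\<close> and
  \<open>\<mu>(X, Y) = - (\<Sum> \<mu>(X, Z))\<close> over \<open>X \<le> Z < Y\<close>; junk value 0 if \<open>P\<close> is infinite or \<open>X \<le> Y\<close> fails
  in \<open>P\<close>.\<close>

function moebius :: "'a set set \<Rightarrow> 'a set \<Rightarrow> 'a set \<Rightarrow> int" where
  "moebius P X Y =
    (if finite P \<and> X \<in> P \<and> Y \<in> P \<and> Y \<subseteq> X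
     then if X = Y then 1 else - (\<Sum>Z\<in>{Z \<in> P. Z \<subseteq> X \<and> Y \<subset> Z}. moebius P X Z)
     else 0)"
  by pat_completeness auto
termination
proof (relation "Wellfounded.measure (\<lambda>(P, X, Y). card {W \<in> P. Y \<subset> W})", goal_cases)
  case 1
  then show ?case by simp
next
  case (2 P X Y Z)
  then have "{W \<in> P. Z \<subset> W} \<subset> {W \<in> P. Y \<subset> W}" by blast
  with 2 show ?case by (auto intro: psubset_card_mono)
qed

declare moebius.simps [simp del]

text \<open>\<^const>\<open>aff_dim\<close> is integer-valued, being \<open>-1\<close> on the empty set only; the members of the
  intersection poset are nonempty.\<close>

definition chi_poly :: "'a::euclidean_space set set \<Rightarrow> int poly" where
  "chi_poly A =
    (\<Sum>X\<in>intersection_poset A. monom (moebius (intersection_poset A) UNIV X) (nat (aff_dim X)))"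

text \<open>The space \<open>\<real>\<^sup>n\<close> is \<^typ>\<open>real ^ 'n\<close>, where a bijection \<open>e\<close> from \<open>{1..n}\<close> to the index type
  numbers the coordinates: \<open>x\<^sub>i\<close> is \<open>x $ e i\<close>. A graph is a set of two-element subsets of
  \<open>{1..n}\<close>.\<close>

definition Shi :: "nat \<Rightarrow> (nat \<Rightarrow> 'n::finite) \<Rightarrow> nat set set \<Rightarrow> (real ^ 'n) set set" where
  "Shi n e G =
    {{x. x $ e i - x $ e j = 0} | i j. 1 \<le> i \<and> i < j \<and> j \<le> n} \<union>
    {{x. x $ e i - x $ e j = 1} | i j. i < j \<and> {i, j} \<in> G}"

definition Ish :: "nat \<Rightarrow> (nat \<Rightarrow> 'n::finite) \<Rightarrow> nat set set \<Rightarrow> (real ^ 'n) set set" where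
  "Ish n e G =
    {{x. x $ e i - x $ e j = 0} | i j. 1 \<le> i \<and> i < j \<and> j \<le> n} \<union>
    {{x. x $ e 1 - x $ e j = real i} | i j. i < j \<and> {i, j} \<in> G}"

end

theory Submission
  imports Defs "HOL-Number_Theory.Cong"
begin

text \<open>By Whitney's theorem the characteristic polynomial is a signed sum over the consistent subsystems
  of the arrangement. All equations have the form \<open>x\<^sub>a - x\<^sub>b = c\<close> with \<open>c\<close> an integer, so for every
  large modulus \<open>p\<close> a subsystem with solution space of dimension \<open>d\<close> has \<open>p\<^sup>d\<close> solutions modulo \<open>p\<close>, and
  the value at \<open>p\<close> counts the points modulo \<open>p\<close> that avoid the arrangement. Avoiding the braid
  arrangement means injectivity; inclusion-exclusion over the remaining hyperplanes leaves, for each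
  set \<open>S\<close> of edges, the injections satisfying the equations of \<open>S\<close>. For both arrangements there are none
  unless \<open>S\<close> is a placement of non-attacking rooks, and otherwise
  \<open>p (p - k - 1) \<cdots> (p - n + 1)\<close> with \<open>k = |S|\<close>. Such placements are exactly the arc sets of
  \<open>G\<close>-partitions with \<open>n - k\<close> blocks.\<close>

section \<open>Whitney's theorem\<close>

text \<open>Why both arrangements lead to rook placements: for an injection \<open>x\<close>, two
  pairs with the same left end \<open>i\<close> force equal values at their right ends. Two pairs
  with the same right end force equal values at their left ends in the Shi case, and equal left ends
  modulo p in the Ish case, where they are positive numbers below n <= p.

  Why the counts agree: \<open>x 1\<close> is arbitrary, which gives the factor p. In the Shi case
  every pair places \<open>j\<close> directly below \<open>i\<close> on the circle of residues;
  gluing each pair removes k points and k positions and leaves the same choices. The obstacle there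
  is that a pair may wrap around from p - 1 to 0. Rotating to x 1 = p - 1 cuts the circle at a place
  that no pair crosses, because 1 is never a right end.

  Why the modulus must be large: a system without real solutions may be solvable modulo a small p,
  and the counts require n <= p. Both exclude finitely many p only, which is harmless for an
  identity of polynomials.\<close>

lemma sum_neg_one_power_card_Pow:
  assumes "finite A"
  shows "(\<Sum>B\<in>Pow A. (-1::int) ^ card B) = (if A = {} then 1 else 0)"
  using assms
proof (induction A rule: finite_induct)
  case (insert a A)
  have "(\<Sum>B\<in>insert a ` Pow A. (-1::int) ^ card B) = (\<Sum>B\<in>Pow A. (-1) ^ card (insert a B))"
    using insert by (intro sum.reindex_cong[of "insert a"]) (auto simp: inj_on_def)
  also have "\<dots> = (\<Sum>B\<in>Pow A. - ((-1) ^ card B))"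
  proof (rule sum.cong)
    fix B assume "B \<in> Pow A"
    then have "finite B" "a \<notin> B" using insert by (auto intro: finite_subset)
    then show "(-1::int) ^ card (insert a B) = - ((-1) ^ card B)" by simp
  qed simp
  finally have *: "(\<Sum>B\<in>insert a ` Pow A. (-1::int) ^ card B) = - (\<Sum>B\<in>Pow A. (-1) ^ card B)"
    by (simp add: sum_negf)
  have "(\<Sum>B\<in>Pow (insert a A). (-1::int) ^ card B) =
      (\<Sum>B\<in>Pow A. (-1) ^ card B) + (\<Sum>B\<in>insert a ` Pow A. (-1) ^ card B)"
    unfolding Pow_insert using insert by (intro sum.union_disjoint) auto
  then show ?case using * by simp
qed simp

text \<open>Inclusion-exclusion by exchanging the sums: a point \<open>x\<close> contributes the
  alternating sum over the subsets of those \<open>t\<close> with \<open>Q t x\<close>, which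
  vanishes unless there are none.\<close>

lemma card_avoiding_all:
  assumes "finite X" "finite T"
  shows "int (card {x \<in> X. \<forall>t\<in>T. \<not> Q t x}) =
    (\<Sum>S\<in>Pow T. (-1) ^ card S * int (card {x \<in> X. \<forall>t\<in>S. Q t x}))"
proof -
  have "(\<Sum>S\<in>Pow T. (-1) ^ card S * int (card {x \<in> X. \<forall>t\<in>S. Q t x})) =
      (\<Sum>S\<in>Pow T. \<Sum>x\<in>X. if \<forall>t\<in>S. Q t x then (-1) ^ card S else 0)"
    using assms by (intro sum.cong) (auto simp: sum.If_cases Int_def)
  also have "\<dots> = (\<Sum>x\<in>X. \<Sum>S\<in>Pow T. if \<forall>t\<in>S. Q t x then (-1) ^ card S else 0)"
    by (rule sum.swap)
  also have "\<dots> = (\<Sum>x\<in>X. \<Sum>S\<in>Pow {t \<in> T. Q t x}. (-1) ^ card S)"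
  proof (rule sum.cong)
    fix x
    have "Pow T \<inter> {S. \<forall>t\<in>S. Q t x} = Pow {t \<in> T. Q t x}" by auto
    then show "(\<Sum>S\<in>Pow T. if \<forall>t\<in>S. Q t x then (-1::int) ^ card S else 0) =
        (\<Sum>S\<in>Pow {t \<in> T. Q t x}. (-1) ^ card S)"
      using assms by (simp add: sum.If_cases)
  qed simp
  also have "\<dots> = (\<Sum>x\<in>X. if \<forall>t\<in>T. \<not> Q t x then 1 else 0)"
    using assms by (intro sum.cong refl) (subst sum_neg_one_power_card_Pow; auto)
  also have "\<dots> = int (card {x \<in> X. \<forall>t\<in>T. \<not> Q t x})"
    using assms by (simp add: sum.If_cases Int_def)
  finally show ?thesis by simp
qed

text \<open>The alternating sums on the right satisfy the recursion that defines the Moebius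
  function: added up over all members of the poset that contain \<open>X\<close>, they give the
  alternating sum over all sets of hyperplanes through \<open>X\<close>, which is 0 unless
  \<open>X\<close> is the whole space.\<close>

lemma moebius_UNIV_eq:
  fixes A :: "'a set set"
  assumes "finite A" "UNIV \<notin> A" "X \<in> intersection_poset A"
  shows "moebius (intersection_poset A) UNIV X = (\<Sum>B\<in>{B. B \<subseteq> A \<and> \<Inter>B = X}. (-1) ^ card B)"
proof -
  let ?P = "intersection_poset A"
  let ?f = "\<lambda>X. \<Sum>B\<in>{B. B \<subseteq> A \<and> \<Inter>B = X}. (-1::int) ^ card B"
  have finP: "finite ?P"
  proof (rule finite_subset)
    show "?P \<subseteq> Inter ` Pow A" by (auto simp: intersection_poset_def)
  qed (use assms in auto)
  have U: "UNIV \<in> ?P" unfolding intersection_poset_def by (force intro: exI[of _ "{}"])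
  have total: "(\<Sum>Z\<in>{Z \<in> ?P. X \<subseteq> Z}. ?f Z) = (if X = UNIV then 1 else 0)" if X: "X \<in> ?P" for X
  proof -
    have "(\<Sum>Z\<in>{Z \<in> ?P. X \<subseteq> Z}. ?f Z) =
        (\<Sum>B\<in>(\<Union>Z\<in>{Z \<in> ?P. X \<subseteq> Z}. {B. B \<subseteq> A \<and> \<Inter>B = Z}). (-1::int) ^ card B)"
      using finP assms(1) by (intro sum.UNION_disjoint[symmetric]) auto
    also have "(\<Union>Z\<in>{Z \<in> ?P. X \<subseteq> Z}. {B. B \<subseteq> A \<and> \<Inter>B = Z}) = Pow {H \<in> A. X \<subseteq> H}"
    proof -
      \<comment> \<open>Nonemptiness of \<open>X\<close> puts the intersection of any hyperplanes
        through \<open>X\<close> into the poset, so every such set of hyperplanes is reached by some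
        \<open>Z\<close>.\<close>
      have "X \<noteq> {}" using X by (auto simp: intersection_poset_def)
      then show ?thesis by (auto simp: intersection_poset_def) blast+
    qed
    also have "(\<Sum>B\<in>Pow {H \<in> A. X \<subseteq> H}. (-1::int) ^ card B) = (if {H \<in> A. X \<subseteq> H} = {} then 1 else 0)"
      using assms by (intro sum_neg_one_power_card_Pow) simp
    \<comment> \<open>A proper \<open>X\<close> is cut out by at least one hyperplane; the whole
      space lies in none, as \<open>UNIV \<notin> A\<close>.\<close>
    also have "{H \<in> A. X \<subseteq> H} = {} \<longleftrightarrow> X = UNIV"
    proof
      assume *: "{H \<in> A. X \<subseteq> H} = {}"
      obtain B where B: "B \<subseteq> A" "X = \<Inter>B" using X by (auto simp: intersection_poset_def)
      then have "B \<subseteq> {H \<in> A. X \<subseteq> H}" by auto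
      with * B show "X = UNIV" by auto
    qed (use assms in \<open>auto simp: top.extremum_unique\<close>)
    finally show ?thesis .
  qed
  have fU: "?f UNIV = 1"
  proof -
    have "{Z \<in> ?P. UNIV \<subseteq> Z} = {UNIV}" using U by auto
    then show ?thesis using total[OF U] by simp
  qed
  \<comment> \<open>The number of strictly larger members measures the height of \<open>X\<close>
    above the bottom element \<open>UNIV\<close>, so induction on it follows the Moebius
    recursion.\<close>
  have "card {W \<in> ?P. X \<subset> W} = k \<Longrightarrow> X \<in> ?P \<Longrightarrow> moebius ?P UNIV X = ?f X" for k X
  proof (induction k arbitrary: X rule: less_induct)
    case (less k)
    show ?case
    proof (cases "X = UNIV")
      case True
      then show ?thesis using U finP fU by (subst moebius.simps) auto
    next
      case False
      have IH: "moebius ?P UNIV Z = ?f Z" if Z: "Z \<in> ?P" "X \<subset> Z" for Z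
      proof (rule less.IH[OF _ refl])
        have "{W \<in> ?P. Z \<subset> W} \<subset> {W \<in> ?P. X \<subset> W}" using Z by blast
        then show "card {W \<in> ?P. Z \<subset> W} < k"
          unfolding less.prems(1)[symmetric] using finP by (intro psubset_card_mono) simp
      qed (use Z in auto)
      have "{Z \<in> ?P. X \<subseteq> Z} = insert X {Z \<in> ?P. X \<subset> Z}" using less.prems by auto
      then have "?f X + (\<Sum>Z\<in>{Z \<in> ?P. X \<subset> Z}. ?f Z) = 0"
        using total[OF less.prems(2)] False finP by simp
      moreover have "moebius ?P UNIV X = - (\<Sum>Z\<in>{Z \<in> ?P. X \<subset> Z}. moebius ?P UNIV Z)"
        using less.prems False finP U by (subst moebius.simps) auto
      moreover have "(\<Sum>Z\<in>{Z \<in> ?P. X \<subset> Z}. moebius ?P UNIV Z) = (\<Sum>Z\<in>{Z \<in> ?P. X \<subset> Z}. ?f Z)"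
        using IH by (intro sum.cong) auto
      ultimately show ?thesis by simp
    qed
  qed
  then show ?thesis using assms by blast
qed

text \<open>Each subset of \<open>A\<close> with nonempty intersection belongs to exactly one member
  of the poset, so expanding the Moebius values merges the double sum into one over subsets.
  Inconsistent subsets belong to no member, hence the value 0.\<close>

lemma poly_chi_poly_Whitney:
  fixes A :: "'a::euclidean_space set set"
  assumes "finite A" "UNIV \<notin> A"
  shows "poly (chi_poly A) t =
    (\<Sum>B\<in>Pow A. (-1) ^ card B * (if \<Inter>B = {} then 0 else t ^ nat (aff_dim (\<Inter>B))))"
proof -
  let ?P = "intersection_poset A"
  have finP: "finite ?P"
  proof (rule finite_subset)
    show "?P \<subseteq> Inter ` Pow A" by (auto simp: intersection_poset_def)
  qed (use assms in auto)
  have "poly (chi_poly A) t = (\<Sum>X\<in>?P. moebius ?P UNIV X * t ^ nat (aff_dim X))"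
    by (simp add: chi_poly_def poly_sum poly_monom)
  also have "\<dots> = (\<Sum>X\<in>?P. \<Sum>B\<in>{B. B \<subseteq> A \<and> \<Inter>B = X}. (-1) ^ card B * t ^ nat (aff_dim (\<Inter>B)))"
    using assms by (intro sum.cong) (auto simp: moebius_UNIV_eq sum_distrib_right)
  also have "\<dots> = (\<Sum>B\<in>(\<Union>X\<in>?P. {B. B \<subseteq> A \<and> \<Inter>B = X}). (-1) ^ card B * t ^ nat (aff_dim (\<Inter>B)))"
    using finP assms(1) by (intro sum.UNION_disjoint[symmetric]) auto
  also have "(\<Union>X\<in>?P. {B. B \<subseteq> A \<and> \<Inter>B = X}) = {B \<in> Pow A. \<Inter>B \<noteq> {}}"
    by (auto simp: intersection_poset_def)
  also have "(\<Sum>B\<in>{B \<in> Pow A. \<Inter>B \<noteq> {}}. (-1) ^ card B * t ^ nat (aff_dim (\<Inter>B))) =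
      (\<Sum>B\<in>Pow A. (-1) ^ card B * (if \<Inter>B = {} then 0 else t ^ nat (aff_dim (\<Inter>B))))"
    using assms by (intro sum.mono_neutral_cong_left) auto
  finally show ?thesis .
qed

section \<open>The finite field method\<close>

text \<open>The constant is an integer so that the same triple can be read as a real hyperplane here
  and as a congruence in \<open>cong_solutions\<close>.\<close>

definition diff_hyperplane :: "(nat \<Rightarrow> 'n::finite) \<Rightarrow> nat \<times> nat \<times> int \<Rightarrow> (real ^ 'n) set" where
  "diff_hyperplane e = (\<lambda>(i, j, c). {x. x $ e i - x $ e j = of_int c})"

definition cong_solutions :: "nat \<Rightarrow> nat \<Rightarrow> (nat \<times> nat \<times> int) set \<Rightarrow> (nat \<Rightarrow> int) set" where
  "cong_solutions n p T =
    {x \<in> {1..n} \<rightarrow>\<^sub>E {0..<int p}. \<forall>(i, j, c)\<in>T. [x i - x j = c] (mod int p)}"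

text \<open>The normal-vector form is the one to which the library facts on hyperplanes and affine
  dimension apply.\<close>

lemma diff_hyperplane_inner:
  "diff_hyperplane e (i, j, c) = {x. (axis (e i) 1 - axis (e j) 1) \<bullet> x = of_int c}"
  by (simp add: diff_hyperplane_def inner_diff_left inner_axis')

lemma affine_Inter_diff_hyperplane: "affine (\<Inter>(diff_hyperplane e ` T))"
  by (intro affine_Inter) (auto simp: diff_hyperplane_inner affine_hyperplane)

lemma finite_cong_solutions: "finite (cong_solutions n p T)"
  by (rule finite_subset[of _ "{1..n} \<rightarrow>\<^sub>E {0..<int p}"])
     (auto simp: cong_solutions_def intro!: finite_PiE)

text \<open>A system of equations \<open>x\<^sub>a - x\<^sub>b = c\<close> is a weighted graph: either \<open>i\<close> and \<open>j\<close> are joined by a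
  path, whose total weight is \<open>x\<^sub>i - x\<^sub>j\<close>, or the component \<open>C\<close> of \<open>i\<close> can be shifted freely.\<close>

lemma path_or_component:
  fixes T :: "(nat \<times> nat \<times> int) set" and e :: "nat \<Rightarrow> 'n::finite"
  obtains (path) d where
      "\<And>x. x \<in> \<Inter>(diff_hyperplane e ` T) \<Longrightarrow> x $ e i - x $ e j = of_int d"
      "\<And>x p. \<forall>(a, b, c)\<in>T. [x a - x b = c] (mod int p) \<Longrightarrow> [x i - x j = d] (mod int p)"
    | (component) C where "i \<in> C" "j \<notin> C" "\<And>a b c. (a, b, c) \<in> T \<Longrightarrow> a \<in> C \<longleftrightarrow> b \<in> C"
proof -
  define R where "R = {(a, b). \<exists>c. (a, b, c) \<in> T \<or> (b, a, c) \<in> T}"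
  show thesis
  proof (cases "(i, j) \<in> R\<^sup>*")
    case True
    \<comment> \<open>Both readings are proved in one induction so that a single \<open>d\<close>
      serves the reals and all moduli.\<close>
    have "\<exists>d. (\<forall>x\<in>\<Inter>(diff_hyperplane e ` T). x $ e i - x $ e j = of_int d) \<and>
        (\<forall>x p. (\<forall>(a, b, c)\<in>T. [x a - x b = c] (mod int p)) \<longrightarrow> [x i - x j = d] (mod int p))"
      using True
    proof (induction rule: rtrancl_induct)
      case base
      then show ?case by (intro exI[of _ 0]) simp
    next
      case (step k l)
      obtain d where d: "\<forall>x\<in>\<Inter>(diff_hyperplane e ` T). x $ e i - x $ e k = of_int d"
        "\<forall>x p. (\<forall>(a, b, c)\<in>T. [x a - x b = c] (mod int p)) \<longrightarrow> [x i - x k = d] (mod int p)"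
        using step by blast
      obtain c where c: "(k, l, c) \<in> T \<or> (l, k, c) \<in> T" using step by (auto simp: R_def)
      \<comment> \<open>An equation traversed against its orientation contributes the negated
        constant.\<close>
      define s where "s = (if (k, l, c) \<in> T then c else - c)"
      have r: "x $ e i - x $ e l = of_int (d + s)" if x: "x \<in> \<Inter>(diff_hyperplane e ` T)" for x
      proof -
        have "x $ e i - x $ e k = of_int d" using d x by blast
        moreover have "x $ e k - x $ e l = of_int s"
        proof (cases "(k, l, c) \<in> T")
          case True
          then have "x \<in> diff_hyperplane e (k, l, c)" using x by blast
          then show ?thesis using True by (simp add: diff_hyperplane_def s_def)
        next
          case False
          then have "x \<in> diff_hyperplane e (l, k, c)" using x c by blast
          then show ?thesis using False by (simp add: diff_hyperplane_def s_def)
        qed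
        ultimately show ?thesis by simp
      qed
      have m: "[x i - x l = d + s] (mod int p)"
        if x: "\<forall>(a, b, c)\<in>T. [x a - x b = c] (mod int p)" for x and p
      proof -
        have 1: "[x i - x k = d] (mod int p)" using d x by blast
        have 2: "[x k - x l = s] (mod int p)"
        proof (cases "(k, l, c) \<in> T")
          case True
          then show ?thesis using x by (auto simp: s_def)
        next
          case False
          then have "[x l - x k = c] (mod int p)" using x c by blast
          then have "[- (x l - x k) = - c] (mod int p)" by (simp only: cong_minus_minus_iff)
          then show ?thesis using False by (simp add: s_def)
        qed
        show ?thesis using cong_add[OF 1 2] by simp
      qed
      show ?case using r m by blast
    qed
    then show thesis using path by blast
  next
    case False
    show thesis
    proof (rule component[of "{k. (i, k) \<in> R\<^sup>*}"])
      fix a b c assume "(a, b, c) \<in> T"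
      then have "(a, b) \<in> R" "(b, a) \<in> R" by (auto simp: R_def)
      then show "a \<in> {k. (i, k) \<in> R\<^sup>*} \<longleftrightarrow> b \<in> {k. (i, k) \<in> R\<^sup>*}"
        by (auto intro: rtrancl_into_rtrancl)
    qed (use False in auto)
  qed
qed

lemma mod_diff_shift_cong: "[(a + k) mod m - (b + l) mod m = c] (mod m) \<longleftrightarrow> [a + k - (b + l) = c] (mod m)"
  for a b c k l m :: int
  by (simp add: cong_def mod_diff_eq)

text \<open>Adding a constant on \<open>C\<close> changes \<open>x i - x j\<close> by that constant
  but leaves every equation of \<open>T\<close> intact, since none of them connects \<open>C\<close>
  with its complement. The opposite shift is the inverse map.\<close>

lemma card_cong_solutions_shift:
  assumes "\<And>a b c. (a, b, c) \<in> T \<Longrightarrow> a \<in> {1..n} \<and> b \<in> {1..n}" "i \<in> {1..n}" "j \<in> {1..n}" "p > 0"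
    and C: "i \<in> C" "j \<notin> C" "\<And>a b c. (a, b, c) \<in> T \<Longrightarrow> a \<in> C \<longleftrightarrow> b \<in> C"
  shows "card (cong_solutions n p (insert (i, j, c) T)) = card (cong_solutions n p (insert (i, j, 0) T))"
proof -
  \<comment> \<open>Reduction modulo p keeps values in the range, and \<open>undefined\<close>
    outside the index set keeps the function extensional.\<close>
  define h where
    "h s x = (\<lambda>k. if k \<in> {1..n} then (x k + (if k \<in> C then s else 0)) mod int p else undefined)"
    for s :: int and x :: "nat \<Rightarrow> int"
  have maps: "h s x \<in> cong_solutions n p (insert (i, j, d + s) T)"
    if x: "x \<in> cong_solutions n p (insert (i, j, d) T)" for s d x
  proof -
    have "h s x \<in> {1..n} \<rightarrow>\<^sub>E {0..<int p}" using \<open>p > 0\<close> by (auto simp: h_def)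
    moreover have "[h s x i - h s x j = d + s] (mod int p)"
    proof -
      have "[x i - x j = d] (mod int p)" using x by (simp add: cong_solutions_def)
      then have "[x i - x j + s = d + s] (mod int p)" by (simp add: cong_add_rcancel)
      then have "[x i + s - (x j + 0) = d + s] (mod int p)" by (simp add: algebra_simps)
      then show ?thesis using assms by (simp only: h_def if_True if_False mod_diff_shift_cong)
    qed
    moreover have "[h s x a - h s x b = c] (mod int p)" if t: "(a, b, c) \<in> T" for a b c
    proof -
      have "[x a - x b = c] (mod int p)" using x t by (auto simp: cong_solutions_def)
      moreover have "a \<in> {1..n}" "b \<in> {1..n}" using assms(1) t by blast+
      ultimately show ?thesis using C(3)[OF t]
        by (simp only: h_def if_True if_False mod_diff_shift_cong) (simp add: algebra_simps)
    qed
    ultimately show ?thesis by (auto simp: cong_solutions_def)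
  qed
  have inv: "h (- s) (h s x) = x" if x: "x \<in> cong_solutions n p S" for s S x
  proof
    fix k
    have "x \<in> {1..n} \<rightarrow>\<^sub>E {0..<int p}" using x by (simp add: cong_solutions_def)
    then show "h (- s) (h s x) k = x k"
      by (cases "k \<in> {1..n}") (auto simp: h_def mod_simps PiE_iff extensional_def)
  qed
  have "bij_betw (h (- c)) (cong_solutions n p (insert (i, j, c) T)) (cong_solutions n p (insert (i, j, 0) T))"
    using maps[of _ c "- c"] maps[of _ 0 c] inv[of _ _ c] inv[of _ _ "- c"]
    by (intro bij_betw_byWitness[where f' = "h c"]) auto
  then show ?thesis by (rule bij_betw_same_card)
qed

text \<open>The solutions split according to the residue of \<open>x i - x j\<close>, and by
  shifting all p classes have the same size.\<close>

lemma card_cong_solutions_component: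
  assumes "\<And>a b c. (a, b, c) \<in> T \<Longrightarrow> a \<in> {1..n} \<and> b \<in> {1..n}" "i \<in> {1..n}" "j \<in> {1..n}" "p > 0"
    and C: "i \<in> C" "j \<notin> C" "\<And>a b c. (a, b, c) \<in> T \<Longrightarrow> a \<in> C \<longleftrightarrow> b \<in> C"
  shows "card (cong_solutions n p T) = p * card (cong_solutions n p (insert (i, j, c) T))"
proof -
  have "cong_solutions n p T = (\<Union>d\<in>{0..<int p}. cong_solutions n p (insert (i, j, d) T))"
  proof safe
    fix x assume x: "x \<in> cong_solutions n p T"
    have "(x i - x j) mod int p \<in> {0..<int p}" using \<open>p > 0\<close> by simp
    moreover have "x \<in> cong_solutions n p (insert (i, j, (x i - x j) mod int p) T)"
      using x by (simp add: cong_solutions_def)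
    ultimately show "x \<in> (\<Union>d\<in>{0..<int p}. cong_solutions n p (insert (i, j, d) T))" by blast
  qed (auto simp: cong_solutions_def)
  also have "card \<dots> = (\<Sum>d\<in>{0..<int p}. card (cong_solutions n p (insert (i, j, d) T)))"
  proof (rule card_UN_disjoint)
    show "\<forall>d\<in>{0..<int p}. \<forall>d'\<in>{0..<int p}. d \<noteq> d' \<longrightarrow>
        cong_solutions n p (insert (i, j, d) T) \<inter> cong_solutions n p (insert (i, j, d') T) = {}"
      by (auto simp: cong_solutions_def cong_def)
  qed (auto simp: finite_cong_solutions)
  also have "\<dots> = (\<Sum>d\<in>{0..<int p}. card (cong_solutions n p (insert (i, j, c) T)))"
  proof (rule sum.cong)
    fix d
    show "card (cong_solutions n p (insert (i, j, d) T)) = card (cong_solutions n p (insert (i, j, c) T))"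
      by (rule trans[OF card_cong_solutions_shift card_cong_solutions_shift[symmetric]])
         (use assms in blast)+
  qed simp
  finally show ?thesis by simp
qed

text \<open>Adding one equation at a time leaves three cases. The equation is implied, and nothing
  changes on either side; it contradicts the earlier ones, and both sides become empty; or it links
  two components, and the dimension drops by one while the count is divided by p.\<close>

lemma card_cong_solutions_aff_dim:
  fixes e :: "nat \<Rightarrow> 'n::finite"
  assumes e: "bij_betw e {1..n} (UNIV :: 'n set)" and "finite T"
    and "\<And>a b c. (a, b, c) \<in> T \<Longrightarrow> a \<in> {1..n} \<and> b \<in> {1..n}"
  shows "\<forall>\<^sub>F p in sequentially. card (cong_solutions n p T) =
    (if \<Inter>(diff_hyperplane e ` T) = {} then 0 else p ^ nat (aff_dim (\<Inter>(diff_hyperplane e ` T))))"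
  using assms(2,3)
proof (induction T rule: finite_induct)
  case empty
  have "CARD('n) = n" using bij_betw_same_card[OF e] by simp
  moreover have "card (cong_solutions n p {}) = p ^ n" for p
    by (simp add: cong_solutions_def card_PiE)
  ultimately show ?case by (simp add: aff_dim_UNIV)
next
  case (insert t T)
  obtain i j c where t: "t = (i, j, c)" by (cases t)
  have ij: "i \<in> {1..n}" "j \<in> {1..n}" and T: "\<And>a b c. (a, b, c) \<in> T \<Longrightarrow> a \<in> {1..n} \<and> b \<in> {1..n}"
    using insert.prems t by auto
  let ?L = "\<Inter>(diff_hyperplane e ` T)"
  let ?H = "diff_hyperplane e (i, j, c)"
  have L: "\<Inter>(diff_hyperplane e ` insert t T) = ?L \<inter> ?H" using t by auto
  have IH: "\<forall>\<^sub>F p in sequentially. card (cong_solutions n p T) =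
      (if ?L = {} then 0 else p ^ nat (aff_dim ?L))"
    using insert.IH T by blast
  have sub: "cong_solutions n p (insert t T) \<subseteq> cong_solutions n p T" for p
    by (auto simp: cong_solutions_def)
  show ?case
  proof (cases "?L = {}")
    case True
    from IH show ?thesis
    proof eventually_elim
      case (elim p)
      then have "cong_solutions n p T = {}" using True finite_cong_solutions by auto
      then have "cong_solutions n p (insert t T) = {}" using sub[of p] by blast
      then show ?case using L True by simp
    qed
  next
    case False
    show ?thesis
    proof (cases rule: path_or_component[where e = e and T = T and i = i and j = j])
      case (path d)
      show ?thesis
      proof (cases "d = c")
        case True
        then have H: "?L \<inter> ?H = ?L" using path(1) by (auto simp: diff_hyperplane_def)
        have "cong_solutions n p (insert t T) = cong_solutions n p T" for p
          using path(2) True t by (auto simp: cong_solutions_def)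
        then show ?thesis using IH unfolding L H by simp
      next
        case neq: False
        then have "?L \<inter> ?H = {}" using path(1) by (force simp: diff_hyperplane_def)
        \<comment> \<open>The contradiction survives modulo p only if p does not divide
          \<open>d - c\<close>. This is where the threshold for p grows with the system.\<close>
        moreover have "\<forall>\<^sub>F p in sequentially. p > nat \<bar>d - c\<bar>" by (rule eventually_gt_at_top)
        then have "\<forall>\<^sub>F p in sequentially. cong_solutions n p (insert t T) = {}"
        proof eventually_elim
          case (elim p)
          have False if x: "x \<in> cong_solutions n p (insert t T)" for x
          proof -
            have "\<forall>(a, b, c)\<in>T. [x a - x b = c] (mod int p)" and c: "[x i - x j = c] (mod int p)"
              using x t by (auto simp: cong_solutions_def)
            from path(2)[OF this(1)] have "[d = c] (mod int p)"
              using c by (meson cong_sym cong_trans)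
            then have "int p dvd d - c" by (simp add: cong_iff_dvd_diff)
            then have "int p \<le> \<bar>d - c\<bar>" using neq dvd_imp_le_int[of "d - c" "int p"] by simp
            then show False using elim by linarith
          qed
          then show ?case by blast
        qed
        ultimately show ?thesis using L by (simp add: eventually_mono)
      qed
    next
      case (component C)
      \<comment> \<open>Translating a real solution along the component \<open>C\<close> attains
        every difference \<open>r\<close>. The value \<open>c\<close> shows that \<open>?H\<close>
        meets \<open>?L\<close>, the value \<open>c + 1\<close> that it does not contain
        \<open>?L\<close>; together they give the drop of the dimension by exactly one.\<close>
      have shift: "\<exists>y\<in>?L. y $ e i - y $ e j = r" for r
      proof -
        obtain x where x: "x \<in> ?L" using False by blast
        define y where "y = (\<chi> k. x $ k +
          (if k \<in> e ` (C \<inter> {1..n}) then r - (x $ e i - x $ e j) else 0))"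
        have mem: "e k \<in> e ` (C \<inter> {1..n}) \<longleftrightarrow> k \<in> C" if "k \<in> {1..n}" for k
          using inj_onD[OF bij_betw_imp_inj_on[OF e]] that by blast
        have "y $ e i - y $ e j = r" using mem ij component by (simp add: y_def)
        moreover have "y \<in> diff_hyperplane e (a, b, c)" if t: "(a, b, c) \<in> T" for a b c
        proof -
          have "x \<in> diff_hyperplane e (a, b, c)" using x t by blast
          moreover have "e a \<in> e ` (C \<inter> {1..n}) \<longleftrightarrow> e b \<in> e ` (C \<inter> {1..n})"
            using mem T[OF t] component(3)[OF t] by simp
          ultimately show ?thesis by (simp add: y_def diff_hyperplane_def)
        qed
        ultimately show ?thesis by (intro bexI[of _ y]) auto
      qed
      have ne: "?L \<inter> ?H \<noteq> {}" using shift[of "of_int c"] by (auto simp: diff_hyperplane_def)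
      moreover have "\<not> ?L \<subseteq> ?H"
      proof
        assume *: "?L \<subseteq> ?H"
        obtain y where "y \<in> ?L" and y: "y $ e i - y $ e j = of_int c + 1" using shift by blast
        with * have "y \<in> ?H" by blast
        then show False using y by (simp add: diff_hyperplane_def)
      qed
      ultimately have dim: "aff_dim (?L \<inter> ?H) = aff_dim ?L - 1"
        using aff_dim_affine_Int_hyperplane[OF affine_Inter_diff_hyperplane[of e T]]
        unfolding diff_hyperplane_inner by auto
      \<comment> \<open>Needed because \<open>nat\<close> would hide the drop from 0 to -1.\<close>
      moreover have "aff_dim (?L \<inter> ?H) \<ge> 0" using ne aff_dim_negative_iff[of "?L \<inter> ?H"] by linarith
      ultimately have Suc: "nat (aff_dim ?L) = Suc (nat (aff_dim (?L \<inter> ?H)))" by simp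
      from IH eventually_gt_at_top[of 0] show ?thesis
      proof eventually_elim
        case (elim p)
        have c: "card (cong_solutions n p T) = p * card (cong_solutions n p (insert t T))"
          unfolding t using T ij elim component by (intro card_cong_solutions_component) auto
        have "p * card (cong_solutions n p (insert t T)) = p ^ nat (aff_dim ?L)"
          unfolding c[symmetric] using elim(1) False by simp
        also have "\<dots> = p * p ^ nat (aff_dim (?L \<inter> ?H))" by (simp add: Suc)
        finally show ?case using L ne elim(2) by simp
      qed
    qed
  qed
qed

text \<open>The finite field method; only \<open>x\<^sub>i - x\<^sub>j\<close> occurs, so the modulus need not be prime.\<close>

theorem poly_chi_poly_eq_card:
  fixes e :: "nat \<Rightarrow> 'n::finite"
  assumes e: "bij_betw e {1..n} (UNIV :: 'n set)" and fin: "finite T"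
    and T: "\<And>a b c. (a, b, c) \<in> T \<Longrightarrow> 1 \<le> a \<and> a < b \<and> b \<le> n"
  shows "\<forall>\<^sub>F p in sequentially. poly (chi_poly (diff_hyperplane e ` T)) (int p) =
    int (card {x \<in> {1..n} \<rightarrow>\<^sub>E {0..<int p}. \<forall>(i, j, c)\<in>T. \<not> [x i - x j = c] (mod int p)})"
proof -
  have e_eq: "e a = e b \<longleftrightarrow> a = b" if "a \<in> {1..n}" "b \<in> {1..n}" for a b
    using bij_betw_imp_inj_on[OF e] that by (rule inj_on_eq_iff)
  \<comment> \<open>Whitney's sum runs over sets of hyperplanes, the counting over sets of triples;
    they correspond because distinct triples give distinct hyperplanes. The orientation
    \<open>a < b\<close> matters here: (i, j, c) and (j, i, -c) would describe the same
    hyperplane.\<close>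
  have inj: "inj_on (diff_hyperplane e) T"
  proof (rule inj_onI)
    fix t t' assume t: "t \<in> T" "t' \<in> T" "diff_hyperplane e t = diff_hyperplane e t'"
    obtain i j c where ijc: "t = (i, j, c)" by (cases t)
    obtain k l d where kld: "t' = (k, l, d)" by (cases t')
    have ij: "1 \<le> i" "i < j" "j \<le> n" and kl: "1 \<le> k" "k < l" "l \<le> n"
      using T t ijc kld by auto
    have key: "x $ e k - x $ e l = of_int d" if "x $ e i - x $ e j = of_int c"
      for x :: "real ^ 'n"
      using t(3) that by (auto simp: diff_hyperplane_def ijc kld set_eq_iff)
    \<comment> \<open>Test points: \<open>x0\<close> lies on the first hyperplane, and so does
      \<open>x m\<close>, which adds 1 in coordinate \<open>m\<close>, as long as \<open>m\<close>
      is neither \<open>i\<close> nor \<open>j\<close>. If such an \<open>m\<close> were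
      \<open>k\<close> or \<open>l\<close>, the two points could not both lie on the second
      hyperplane.\<close>
    define x :: "nat \<Rightarrow> real ^ 'n" where
      "x m = (\<chi> u. (if u = e i then of_int c else 0) + (if u = e m then 1 else 0))" for m
    define x0 :: "real ^ 'n" where "x0 = (\<chi> u. if u = e i then of_int c else 0)"
    have e_ij: "e i \<noteq> e j" and e_kl: "e k \<noteq> e l" using e_eq ij kl by auto
    have k: "x0 $ e k - x0 $ e l = of_int d" using e_ij by (intro key) (simp add: x0_def)
    have mem: "k = i \<or> k = j" "l = i \<or> l = j"
    proof -
      show "k = i \<or> k = j"
      proof (rule ccontr)
        assume "\<not> (k = i \<or> k = j)"
        then have "e k \<noteq> e i" "e k \<noteq> e j" using e_eq ij kl by auto
        then have "x k $ e k - x k $ e l = of_int d" using e_ij by (intro key) (simp add: x_def)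
        then show False using k e_kl \<open>e k \<noteq> e i\<close> by (auto simp: x_def x0_def split: if_splits)
      qed
      show "l = i \<or> l = j"
      proof (rule ccontr)
        assume "\<not> (l = i \<or> l = j)"
        then have "e l \<noteq> e i" "e l \<noteq> e j" using e_eq ij kl by auto
        then have "x l $ e k - x l $ e l = of_int d" using e_ij by (intro key) (simp add: x_def)
        then show False using k e_kl \<open>e l \<noteq> e i\<close> by (auto simp: x_def x0_def split: if_splits)
      qed
    qed
    then have "k = i" "l = j" using ij kl by auto
    moreover then have "d = c" using k e_ij by (simp add: x0_def)
    ultimately show "t = t'" using ijc kld by simp
  qed
  have nU: "UNIV \<notin> diff_hyperplane e ` T"
  proof
    assume "UNIV \<in> diff_hyperplane e ` T"
    then obtain i j c where t: "(i, j, c) \<in> T" and U: "\<And>x. x \<in> diff_hyperplane e (i, j, c)"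
      by (metis UNIV_I imageE prod_cases3)
    have "e i \<noteq> e j" using T[OF t] e_eq[of i j] by auto
    moreover have "(\<chi> u. if u = e i then of_int c + 1 else 0) \<in> diff_hyperplane e (i, j, c)" by (rule U)
    ultimately show False by (simp add: diff_hyperplane_def)
  qed
  \<comment> \<open>\<open>T\<close> has finitely many subsets, so one threshold for p serves all of
    them.\<close>
  have "\<forall>\<^sub>F p in sequentially. \<forall>S\<in>Pow T. card (cong_solutions n p S) =
      (if \<Inter>(diff_hyperplane e ` S) = {} then 0 else p ^ nat (aff_dim (\<Inter>(diff_hyperplane e ` S))))"
  proof (intro eventually_ball_finite ballI card_cong_solutions_aff_dim[OF e])
    fix S a b c assume "S \<in> Pow T" "(a, b, c) \<in> S"
    then show "a \<in> {1..n} \<and> b \<in> {1..n}" using T[of a b c] by auto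
  qed (use fin in \<open>auto intro: finite_subset\<close>)
  then show ?thesis
  proof eventually_elim
    case (elim p)
    let ?X = "{1..n} \<rightarrow>\<^sub>E {0..<int p}"
    have "poly (chi_poly (diff_hyperplane e ` T)) (int p) =
        (\<Sum>B\<in>Pow (diff_hyperplane e ` T).
          (-1) ^ card B * (if \<Inter>B = {} then 0 else int p ^ nat (aff_dim (\<Inter>B))))"
      using fin nU by (intro poly_chi_poly_Whitney) auto
    also have "\<dots> = (\<Sum>S\<in>Pow T. (-1) ^ card S * (if \<Inter>(diff_hyperplane e ` S) = {} then 0
        else int p ^ nat (aff_dim (\<Inter>(diff_hyperplane e ` S)))))"
    proof (rule sum.reindex_cong[of "image (diff_hyperplane e)"])
      show "inj_on (image (diff_hyperplane e)) (Pow T)" using inj by (rule inj_on_image_Pow)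
      show "Pow (diff_hyperplane e ` T) = image (diff_hyperplane e) ` Pow T" by (simp add: image_Pow_surj)
      fix S assume "S \<in> Pow T"
      then have "card (diff_hyperplane e ` S) = card S"
        using inj by (intro card_image) (auto intro: inj_on_subset)
      then show "(-1) ^ card (diff_hyperplane e ` S) * (if \<Inter>(diff_hyperplane e ` S) = {} then 0
          else int p ^ nat (aff_dim (\<Inter>(diff_hyperplane e ` S)))) = (-1) ^ card S *
          (if \<Inter>(diff_hyperplane e ` S) = {} then 0 else int p ^ nat (aff_dim (\<Inter>(diff_hyperplane e ` S))))"
        by simp
    qed
    also have "\<dots> = (\<Sum>S\<in>Pow T. (-1) ^ card S * int (card (cong_solutions n p S)))"
      using elim by (intro sum.cong) auto
    also have "\<dots> = (\<Sum>S\<in>Pow T. (-1) ^ card S * int (card {x \<in> ?X. \<forall>t\<in>S.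
        case t of (i, j, c) \<Rightarrow> [x i - x j = c] (mod int p)}))"
      by (simp add: cong_solutions_def)
    also have "\<dots> = int (card {x \<in> ?X. \<forall>t\<in>T. \<not> (case t of (i, j, c) \<Rightarrow> [x i - x j = c] (mod int p))})"
      using fin by (intro card_avoiding_all[symmetric]) (auto intro: finite_PiE)
    also have "{x \<in> ?X. \<forall>t\<in>T. \<not> (case t of (i, j, c) \<Rightarrow> [x i - x j = c] (mod int p))} =
        {x \<in> ?X. \<forall>(i, j, c)\<in>T. \<not> [x i - x j = c] (mod int p)}"
      by (simp add: case_prod_unfold)
    finally show ?case .
  qed
qed

section \<open>Partitions and rook placements\<close>

definition rook_placement :: "('a \<times> 'b) set \<Rightarrow> bool" where
  "rook_placement S \<longleftrightarrow> inj_on fst S \<and> inj_on snd S"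

text \<open>Comparability along directed paths stands in for the equivalence relation generated by
  \<open>S\<close>: in a rook placement every element has at most one successor and one predecessor,
  so connected elements lie on a common directed path.\<close>

definition chain_rel :: "nat \<Rightarrow> (nat \<times> nat) set \<Rightarrow> (nat \<times> nat) set" where
  "chain_rel n S = {(a, b). a \<in> {1..n} \<and> b \<in> {1..n} \<and> ((a, b) \<in> S\<^sup>* \<or> (b, a) \<in> S\<^sup>*)}"

lemma arcsD:
  assumes "partition_on {1..n} P" "(i, j) \<in> arcs P"
  shows "1 \<le> i" "i < j" "j \<le> n"
proof -
  obtain B where "B \<in> P" "i \<in> B" "j \<in> B" and "i < j" using assms(2) by (auto simp: arcs_def)
  moreover have "B \<subseteq> {1..n}" using assms(1) \<open>B \<in> P\<close> by (auto simp: partition_on_def)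
  ultimately show "1 \<le> i" "i < j" "j \<le> n" by auto
qed

lemma partition_on_same_block:
  assumes "partition_on A P" "B \<in> P" "C \<in> P" "x \<in> B" "x \<in> C"
  shows "B = C"
  using assms by (auto simp: partition_on_def pairwise_def disjnt_def)

text \<open>Blocks are disjoint, and within its block an element has at most one next and at most
  one previous element.\<close>

lemma rook_placement_arcs:
  assumes P: "partition_on {1..n} P"
  shows "rook_placement (arcs P)"
  unfolding rook_placement_def
proof (intro conjI inj_onI)
  fix s t assume s: "s \<in> arcs P" "t \<in> arcs P" "fst s = fst t"
  obtain i j k where ijk: "s = (i, j)" "t = (i, k)" using s(3) by (cases s, cases t) auto
  obtain B where B: "B \<in> P" "i \<in> B" "j \<in> B" "i < j" "\<not> (\<exists>l\<in>B. i < l \<and> l < j)"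
    using s ijk by (auto simp: arcs_def)
  obtain C where C: "C \<in> P" "i \<in> C" "k \<in> C" "i < k" "\<not> (\<exists>l\<in>C. i < l \<and> l < k)"
    using s ijk by (auto simp: arcs_def)
  have "B = C" using partition_on_same_block[OF P B(1) C(1) B(2) C(2)] .
  then have "j = k" using B C by (meson linorder_neqE_nat)
  then show "s = t" using ijk by simp
next
  fix s t assume s: "s \<in> arcs P" "t \<in> arcs P" "snd s = snd t"
  obtain i j k where ijk: "s = (j, i)" "t = (k, i)" using s(3) by (cases s, cases t) auto
  obtain B where B: "B \<in> P" "j \<in> B" "i \<in> B" "j < i" "\<not> (\<exists>l\<in>B. j < l \<and> l < i)"
    using s ijk by (auto simp: arcs_def)
  obtain C where C: "C \<in> P" "k \<in> C" "i \<in> C" "k < i" "\<not> (\<exists>l\<in>C. k < l \<and> l < i)"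
    using s ijk by (auto simp: arcs_def)
  have "B = C" using partition_on_same_block[OF P B(1) C(1) B(3) C(3)] .
  then have "j = k" using B C by (meson linorder_neqE_nat)
  then show "s = t" using ijk by simp
qed

text \<open>An element is the right end of an arc iff it is not the minimum of its block, and then
  of exactly one arc; so the arcs correspond to the elements other than the block minima.\<close>

lemma card_arcs:
  assumes P: "partition_on {1..n} P"
  shows "card (arcs P) + card P = n"
proof -
  have fin: "finite B" "B \<noteq> {}" "B \<subseteq> {1..n}" if "B \<in> P" for B
  proof -
    show "B \<noteq> {}" "B \<subseteq> {1..n}" using P that by (auto simp: partition_on_def)
    then show "finite B" by (auto intro: finite_subset)
  qed
  have "snd ` arcs P = {1..n} - Min ` P"
  proof (intro set_eqI iffI)
    fix j assume "j \<in> snd ` arcs P"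
    then obtain i where ij: "(i, j) \<in> arcs P" by auto
    then obtain B where B: "B \<in> P" "i \<in> B" "j \<in> B" "i < j" by (auto simp: arcs_def)
    have "j \<noteq> Min C" if C: "C \<in> P" for C
    proof
      assume j: "j = Min C"
      then have "j \<in> C" using fin[OF C] by simp
      then have "C = B" using partition_on_same_block[OF P C B(1)] B by blast
      then have "Min C \<le> i" using fin[OF C] B by simp
      then show False using j B by simp
    qed
    then show "j \<in> {1..n} - Min ` P" using arcsD[OF P ij] by auto
  next
    fix j assume j: "j \<in> {1..n} - Min ` P"
    then obtain B where B: "B \<in> P" "j \<in> B" using partition_onD1[OF P] by blast
    let ?L = "{l \<in> B. l < j}"
    have "Min B \<in> ?L" using j B fin[OF B(1)] by (auto simp: order.strict_iff_order)
    then have ne: "?L \<noteq> {}" by blast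
    have finL: "finite ?L" using fin[OF B(1)] by simp
    have "Max ?L \<in> ?L" using Max_in[OF finL ne] .
    moreover have "\<not> (\<exists>l\<in>B. Max ?L < l \<and> l < j)" using finL by (auto simp: not_less)
    ultimately have "(Max ?L, j) \<in> arcs P" unfolding arcs_def using B by blast
    then show "j \<in> snd ` arcs P" by force
  qed
  moreover have "card (snd ` arcs P) = card (arcs P)"
    using rook_placement_arcs[OF P] by (intro card_image) (simp add: rook_placement_def)
  moreover have "card (Min ` P) = card P"
  proof (intro card_image inj_onI)
    fix B C assume BC: "B \<in> P" "C \<in> P" "Min B = Min C"
    then have "Min B \<in> B" "Min B \<in> C" using fin Min_in by metis+
    then show "B = C" using partition_on_same_block[OF P] BC by blast
  qed
  moreover have MinP: "Min ` P \<subseteq> {1..n}" using fin Min_in by fastforce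
  moreover have "card (Min ` P) \<le> n" using card_mono[OF _ MinP] by simp
  ultimately show ?thesis by (simp add: card_Diff_subset finite_subset)
qed

text \<open>Arcs never leave a block, and two elements of a block are joined by the arcs between
  consecutive elements. Hence a partition can be recovered from its arcs.\<close>

lemma chain_rel_arcs:
  assumes P: "partition_on {1..n} P"
  shows "chain_rel n (arcs P) = {(x, y). \<exists>B\<in>P. x \<in> B \<and> y \<in> B}"
proof -
  have 1: "\<exists>B\<in>P. x \<in> B \<and> y \<in> B" if "(x, y) \<in> (arcs P)\<^sup>*" "x \<in> {1..n}" for x y
    using that
  proof (induction rule: rtrancl_induct)
    case base
    then show ?case using P by (auto simp: partition_on_def)
  next
    case (step y z)
    then obtain B where B: "B \<in> P" "x \<in> B" "y \<in> B" by auto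
    obtain C where C: "C \<in> P" "y \<in> C" "z \<in> C" using step by (auto simp: arcs_def)
    have "B = C" using partition_on_same_block[OF P B(1) C(1) B(3) C(2)] .
    then show ?case using B C by blast
  qed
  have 2: "(x, y) \<in> (arcs P)\<^sup>*" if B: "B \<in> P" "x \<in> B" "y \<in> B" "x \<le> y" for x y B
    \<comment> \<open>Splitting at an element of the block strictly in between shortens both gaps;
      if there is none, the pair is an arc.\<close>
    using B
  proof (induction "y - x" arbitrary: x y rule: less_induct)
    case less
    show ?case
    proof (cases "\<exists>l\<in>B. x < l \<and> l < y")
      case True
      then obtain l where l: "l \<in> B" "x < l" "l < y" by blast
      then have "(x, l) \<in> (arcs P)\<^sup>*" "(l, y) \<in> (arcs P)\<^sup>*" using less by auto
      then show ?thesis by simp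
    next
      case False
      then show ?thesis using less by (cases "x = y") (auto simp: arcs_def intro!: r_into_rtrancl)
    qed
  qed
  have 3: "x \<in> {1..n}" if "B \<in> P" "x \<in> B" for x B using P that by (auto simp: partition_on_def)
  show ?thesis
  proof (intro set_eqI iffI; clarify)
    fix x y assume "(x, y) \<in> chain_rel n (arcs P)"
    then show "\<exists>B\<in>P. x \<in> B \<and> y \<in> B" using 1[of x y] 1[of y x] by (auto simp: chain_rel_def)
  next
    fix x y B assume "B \<in> P" "x \<in> B" "y \<in> B"
    then show "(x, y) \<in> chain_rel n (arcs P)"
      using 2[of B x y] 2[of B y x] 3[of B x] 3[of B y] nat_le_linear[of x y] by (auto simp: chain_rel_def)
  qed
qed

text \<open>Only transitivity uses the rook condition: of two paths that leave a common point, or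
  enter one, the shorter is part of the longer because \<open>S\<close> and its converse are
  single-valued.\<close>

lemma equiv_chain_rel:
  assumes "rook_placement S"
  shows "equiv {1..n} (chain_rel n S)"
proof (rule equivI)
  have sv: "single_valued S" "single_valued (S\<inverse>)"
    using assms by (force simp: rook_placement_def inj_on_def single_valued_def)+
  show "trans (chain_rel n S)"
  proof (rule transI)
    fix a b c assume "(a, b) \<in> chain_rel n S" "(b, c) \<in> chain_rel n S"
    then have m: "a \<in> {1..n}" "c \<in> {1..n}"
      and ab: "(a, b) \<in> S\<^sup>* \<or> (b, a) \<in> S\<^sup>*" and bc: "(b, c) \<in> S\<^sup>* \<or> (c, b) \<in> S\<^sup>*"
      by (auto simp: chain_rel_def)
    have "(a, c) \<in> S\<^sup>* \<or> (c, a) \<in> S\<^sup>*" if "(b, a) \<in> S\<^sup>*" "(b, c) \<in> S\<^sup>*"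
      using single_valued_confluent[OF sv(1) that] .
    moreover have "(a, c) \<in> S\<^sup>* \<or> (c, a) \<in> S\<^sup>*" if "(a, b) \<in> S\<^sup>*" "(c, b) \<in> S\<^sup>*"
      using single_valued_confluent[OF sv(2), of b a c] that by (auto simp: rtrancl_converse)
    ultimately show "(a, c) \<in> chain_rel n S"
      using m ab bc by (auto simp: chain_rel_def intro: rtrancl_trans)
  qed
qed (auto simp: chain_rel_def refl_on_def sym_def)

text \<open>Paths in \<open>S\<close> increase, and the only way up from \<open>i\<close> within its
  class begins with the unique pair of \<open>S\<close> starting at \<open>i\<close>. The end of
  that pair is therefore the next larger element of the class.\<close>

lemma arcs_chain_rel_quotient:
  assumes rook: "rook_placement S" and S: "\<And>i j. (i, j) \<in> S \<Longrightarrow> 1 \<le> i \<and> i < j \<and> j \<le> n"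
  shows "arcs ({1..n} // chain_rel n S) = S"
proof -
  let ?P = "{1..n} // chain_rel n S"
  note eq = equiv_chain_rel[OF rook, of n]
  have le: "a \<le> b" if "(a, b) \<in> S\<^sup>*" for a b
    using that by (induction rule: rtrancl_induct) (auto dest: S)
  have same: "(\<exists>B\<in>?P. i \<in> B \<and> j \<in> B \<and> \<not> (\<exists>l\<in>B. i < l \<and> l < j)) \<longleftrightarrow>
      (i, j) \<in> chain_rel n S \<and> \<not> (\<exists>l. (i, l) \<in> chain_rel n S \<and> i < l \<and> l < j)" for i j
  proof
    assume "\<exists>B\<in>?P. i \<in> B \<and> j \<in> B \<and> \<not> (\<exists>l\<in>B. i < l \<and> l < j)"
    then obtain B where B: "B \<in> ?P" "i \<in> B" "j \<in> B" "\<not> (\<exists>l\<in>B. i < l \<and> l < j)" by blast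
    have "(i, l) \<in> chain_rel n S \<longleftrightarrow> l \<in> B" for l
      using quotient_eq_iff[OF eq B(1) B(1) B(2), of l] in_quotient_imp_closed[OF eq B(1) B(2), of l]
      by (meson B(1,2) eq in_quotient_imp_in_rel insert_subset empty_subsetI)
    then show "(i, j) \<in> chain_rel n S \<and> \<not> (\<exists>l. (i, l) \<in> chain_rel n S \<and> i < l \<and> l < j)"
      using B by blast
  next
    assume *: "(i, j) \<in> chain_rel n S \<and> \<not> (\<exists>l. (i, l) \<in> chain_rel n S \<and> i < l \<and> l < j)"
    then have "i \<in> {1..n}" by (simp add: chain_rel_def)
    then have "chain_rel n S `` {i} \<in> ?P" "i \<in> chain_rel n S `` {i}"
      by (rule quotientI, rule equiv_class_self[OF eq])
    with * show "\<exists>B\<in>?P. i \<in> B \<and> j \<in> B \<and> \<not> (\<exists>l\<in>B. i < l \<and> l < j)" by blast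
  qed
  have "(i, j) \<in> arcs ?P \<longleftrightarrow> (i, j) \<in> S" for i j
  proof
    assume "(i, j) \<in> arcs ?P"
    then have ij: "i < j" "(i, j) \<in> chain_rel n S" "\<not> (\<exists>l. (i, l) \<in> chain_rel n S \<and> i < l \<and> l < j)"
      unfolding arcs_def using same[of i j] by auto
    then have "(i, j) \<in> S\<^sup>*" using le[of j i] by (auto simp: chain_rel_def)
    then obtain l where l: "(i, l) \<in> S" "(l, j) \<in> S\<^sup>*"
      using ij(1) by (metis converse_rtranclE less_irrefl)
    then have "(i, l) \<in> chain_rel n S" using S[OF l(1)] by (auto simp: chain_rel_def)
    then have "l = j" using ij(3) S[OF l(1)] le[OF l(2)] by (meson order.not_eq_order_implies_strict)
    then show "(i, j) \<in> S" using l by simp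
  next
    assume ij: "(i, j) \<in> S"
    then have "(i, j) \<in> chain_rel n S" using S[OF ij] by (auto simp: chain_rel_def)
    moreover have False if l: "(i, l) \<in> chain_rel n S" "i < l" "l < j" for l
    proof -
      have "(i, l) \<in> S\<^sup>*" using l le[of l i] by (auto simp: chain_rel_def)
      then obtain m where m: "(i, m) \<in> S" "(m, l) \<in> S\<^sup>*"
        using l(2) by (metis converse_rtranclE less_irrefl)
      have "m = j" using rook ij m(1) by (force simp: rook_placement_def inj_on_def)
      then show False using le[OF m(2)] l by simp
    qed
    ultimately show "(i, j) \<in> arcs ?P" unfolding arcs_def using same[of i j] S[OF ij] by auto
  qed
  then show ?thesis by auto
qed

text \<open>\<open>arcs\<close> and the quotient by \<open>chain_rel\<close> are mutually inverse;
  the block count matches because arcs and blocks together number n, with \<open>k \<le> n\<close>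
  making the subtraction exact.\<close>

lemma Stir_eq_card_rook_placements:
  assumes G: "G \<subseteq> {E. E \<subseteq> {1..n} \<and> card E = 2}" and "k \<le> n"
  shows "Stir n G (n - k) =
    card {S. S \<subseteq> {(i, j). i < j \<and> {i, j} \<in> G} \<and> rook_placement S \<and> card S = k}"
  unfolding Stir_def
proof (rule bij_betw_same_card, rule bij_betw_byWitness[where f = arcs and f' = "\<lambda>S. {1..n} // chain_rel n S"])
  let ?D = "{(i, j). i < j \<and> {i, j} \<in> G}"
  have S: "1 \<le> i \<and> i < j \<and> j \<le> n" if "S \<subseteq> ?D" "(i, j) \<in> S" for S i j
    using that G by force
  show "\<forall>P\<in>{P. G_partition n G P \<and> card P = n - k}. {1..n} // chain_rel n (arcs P) = P"
    by (auto simp: G_partition_def chain_rel_arcs partition_on_eq_quotient)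
  show inv: "\<forall>S\<in>{S. S \<subseteq> ?D \<and> rook_placement S \<and> card S = k}. arcs ({1..n} // chain_rel n S) = S"
  proof clarify
    fix S assume "S \<subseteq> ?D" and rook: "rook_placement S"
    then show "arcs ({1..n} // chain_rel n S) = S" using S by (intro arcs_chain_rel_quotient) blast+
  qed
  show "arcs ` {P. G_partition n G P \<and> card P = n - k} \<subseteq> {S. S \<subseteq> ?D \<and> rook_placement S \<and> card S = k}"
  proof clarify
    fix P assume P: "G_partition n G P" "card P = n - k"
    then have part: "partition_on {1..n} P" by (simp add: G_partition_def)
    have "arcs P \<subseteq> ?D" using P by (auto simp: G_partition_def arcs_def)
    moreover have "card (arcs P) = k" using card_arcs[OF part] P(2) \<open>k \<le> n\<close> by simp
    ultimately show "arcs P \<subseteq> ?D \<and> rook_placement (arcs P) \<and> card (arcs P) = k"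
      using rook_placement_arcs[OF part] by blast
  qed
  show "(\<lambda>S. {1..n} // chain_rel n S) ` {S. S \<subseteq> ?D \<and> rook_placement S \<and> card S = k}
      \<subseteq> {P. G_partition n G P \<and> card P = n - k}"
  proof clarify
    fix S assume SD: "S \<subseteq> ?D" and rook: "rook_placement S" and k: "k = card S"
    have part: "partition_on {1..n} ({1..n} // chain_rel n S)"
      using equiv_chain_rel[OF rook] by (rule partition_on_quotient)
    have arcs: "arcs ({1..n} // chain_rel n S) = S" using inv SD rook k by blast
    show "G_partition n G ({1..n} // chain_rel n S) \<and> card ({1..n} // chain_rel n S) = n - card S"
      using card_arcs[OF part] part SD unfolding G_partition_def arcs by auto
  qed
qed

section \<open>Counting injections\<close>

lemma card_inj_insert:
  assumes "finite V" "finite B" "w \<notin> V" and Q: "\<And>f b. Q (f(w := b)) \<longleftrightarrow> Q f"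
  shows "card {f \<in> insert w V \<rightarrow>\<^sub>E B. inj_on f (insert w V) \<and> Q f} =
    card {f \<in> V \<rightarrow>\<^sub>E B. inj_on f V \<and> Q f} * (card B - card V)"
proof -
  let ?F = "\<lambda>V. {f \<in> V \<rightarrow>\<^sub>E B. inj_on f V \<and> Q f}"
  have upd: "inj_on (f(w := b)) (insert w V) \<longleftrightarrow> inj_on f V \<and> b \<notin> f ` V" for f :: "'a \<Rightarrow> 'b" and b
  proof -
    have "inj_on (f(w := b)) V = inj_on f V" using assms(3) by (intro inj_on_cong) auto
    moreover have "(f(w := b)) ` V = f ` V" using assms(3) by (intro image_cong) auto
    ultimately show ?thesis using assms(3) by (auto simp: inj_on_insert)
  qed
  have PiE_upd: "f(w := b) \<in> insert w V \<rightarrow>\<^sub>E B" if "f \<in> V \<rightarrow>\<^sub>E B" "b \<in> B" for f :: "'a \<Rightarrow> 'b" and b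
    using that by (intro PiE_fun_upd)
  have "bij_betw (\<lambda>(f, b). f(w := b)) (SIGMA f:?F V. B - f ` V) (?F (insert w V))"
  \<comment> \<open>Forgetting \<open>w\<close> means resetting it to \<open>undefined\<close>,
    since functions on \<open>V\<close> are extensional.\<close>
  proof (rule bij_betw_byWitness[where f' = "\<lambda>f. (f(w := undefined), f w)"])
    show "\<forall>a\<in>SIGMA f:?F V. B - f ` V. (\<lambda>f. (f(w := undefined), f w)) ((\<lambda>(f, b). f(w := b)) a) = a"
      using assms(3) by (auto simp: PiE_iff extensional_def fun_eq_iff)
    show "\<forall>f\<in>?F (insert w V). (\<lambda>(f, b). f(w := b)) (f(w := undefined), f w) = f" by simp
    show "(\<lambda>(f, b). f(w := b)) ` (SIGMA f:?F V. B - f ` V) \<subseteq> ?F (insert w V)"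
    proof (rule image_subsetI)
      fix a assume "a \<in> (SIGMA f:?F V. B - f ` V)"
      then obtain f b where a: "a = (f, b)" and "f \<in> V \<rightarrow>\<^sub>E B" "inj_on f V" "Q f" "b \<in> B" "b \<notin> f ` V"
        by blast
      then show "(\<lambda>(f, b). f(w := b)) a \<in> ?F (insert w V)"
        unfolding a prod.case using PiE_upd upd[of f b] Q[of f b] by blast
    qed
    show "(\<lambda>f. (f(w := undefined), f w)) ` ?F (insert w V) \<subseteq> (SIGMA f:?F V. B - f ` V)"
    proof (rule image_subsetI)
      fix f assume "f \<in> ?F (insert w V)"
      then have f: "f \<in> insert w V \<rightarrow>\<^sub>E B" "inj_on f (insert w V)" "Q f" by blast+
      have "inj_on (f(w := f w)) (insert w V)" using f by simp
      then have "inj_on f V" "f w \<notin> f ` V" unfolding upd by auto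
      moreover have "inj_on (f(w := undefined)) V = inj_on f V" using assms(3) by (intro inj_on_cong) auto
      moreover have "(f(w := undefined)) ` V = f ` V" using assms(3) by (intro image_cong) auto
      moreover have "f(w := undefined) \<in> V \<rightarrow>\<^sub>E B" "f w \<in> B"
        using f(1) assms(3) by (auto simp: PiE_iff extensional_def)
      ultimately show "(f(w := undefined), f w) \<in> (SIGMA f:?F V. B - f ` V)"
        using Q[of f undefined] f(3) by blast
    qed
  qed
  then have "card (?F (insert w V)) = card (SIGMA f:?F V. B - f ` V)"
    by (rule bij_betw_same_card[symmetric])
  also have "\<dots> = (\<Sum>f\<in>?F V. card (B - f ` V))"
  proof (rule card_SigmaI)
    show "finite (?F V)"
      using assms(1,2) by (intro finite_subset[OF _ finite_PiE[of V "\<lambda>_. B"]]) auto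
  qed (use assms(2) in simp)
  also have "\<dots> = (\<Sum>f\<in>?F V. card B - card V)"
  proof (rule sum.cong)
    fix f assume f: "f \<in> ?F V"
    then have "card (B - f ` V) = card B - card (f ` V)" using assms(1) by (intro card_Diff_subset) auto
    also have "card (f ` V) = card V" using f by (intro card_image) auto
    finally show "card (B - f ` V) = card B - card V" .
  qed simp
  finally show ?thesis by simp
qed

text \<open>The points outside \<open>J\<close> are added one by one; the factor for
  \<open>m\<close> counts the values left when \<open>m\<close> are taken, starting from the values
  of \<open>g\<close> on \<open>J\<close>.\<close>

lemma card_inj_extensions:
  fixes g :: "'a \<Rightarrow> 'b"
  assumes "finite V" "finite B" "J \<subseteq> V" "inj_on g J" "g ` J \<subseteq> B" "card V \<le> card B"
  shows "int (card {f \<in> V \<rightarrow>\<^sub>E B. inj_on f V \<and> (\<forall>j\<in>J. f j = g j)}) =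
    (\<Prod>m = card J..<card V. int (card B) - int m)"
proof -
  have ext: "finite W \<Longrightarrow> W \<inter> J = {} \<Longrightarrow> card J + card W \<le> card B \<Longrightarrow>
    int (card {f \<in> (J \<union> W) \<rightarrow>\<^sub>E B. inj_on f (J \<union> W) \<and> (\<forall>j\<in>J. f j = g j)}) =
    (\<Prod>m = card J..<card J + card W. int (card B) - int m)" for W
  proof (induction W rule: finite_induct)
    case empty
    have "{f \<in> J \<rightarrow>\<^sub>E B. inj_on f J \<and> (\<forall>j\<in>J. f j = g j)} = {restrict g J}"
    proof (intro set_eqI iffI)
      fix f assume "f \<in> {f \<in> J \<rightarrow>\<^sub>E B. inj_on f J \<and> (\<forall>j\<in>J. f j = g j)}"
      then show "f \<in> {restrict g J}" by (auto simp: PiE_iff extensional_def restrict_def fun_eq_iff)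
    qed (use assms in \<open>auto simp: PiE_iff cong: inj_on_cong\<close>)
    then show ?case by simp
  next
    case (insert w W)
    let ?F = "\<lambda>W. {f \<in> (J \<union> W) \<rightarrow>\<^sub>E B. inj_on f (J \<union> W) \<and> (\<forall>j\<in>J. f j = g j)}"
    have w: "w \<notin> J \<union> W" using insert by auto
    have finJ: "finite J" using assms finite_subset by blast
    have "card (?F (insert w W)) = card (?F W) * (card B - card (J \<union> W))"
      unfolding Un_insert_right
    proof (rule card_inj_insert)
      fix f b
      show "(\<forall>j\<in>J. (f(w := b)) j = g j) \<longleftrightarrow> (\<forall>j\<in>J. f j = g j)" using w by auto
    qed (use finJ insert assms w in auto)
    moreover have "card (J \<union> W) = card J + card W"
      using finJ insert by (intro card_Un_disjoint) auto
    ultimately have "card (?F (insert w W)) = card (?F W) * (card B - (card J + card W))" by simp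
    then have "int (card (?F (insert w W))) = int (card (?F W)) * (int (card B) - int (card J + card W))"
      using insert by (simp add: of_nat_diff)
    also have "int (card (?F W)) = (\<Prod>m = card J..<card J + card W. int (card B) - int m)"
      using insert by (intro insert.IH) auto
    finally show ?case using insert by simp
  qed
  have "(V - J) \<inter> J = {}" by blast
  then show ?thesis
    using ext[of "V - J"] assms by (simp add: card_Diff_subset finite_subset card_mono Un_absorb1)
qed

abbreviation injections :: "nat \<Rightarrow> nat \<Rightarrow> (nat \<Rightarrow> int) set" where
  "injections n p \<equiv> {x \<in> {1..n} \<rightarrow>\<^sub>E {0..<int p}. inj_on x {1..n}}"

lemma cong_diff_lcancel: "[a - b = a - c] (mod m) \<longleftrightarrow> [b = c] (mod m)" for a b c m :: int
  using cong_add_lcancel[of a "- b" "- c" m] by (simp add: cong_minus_minus_iff)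

lemma cong_diff_rcancel: "[b - a = c - a] (mod m) \<longleftrightarrow> [b = c] (mod m)" for a b c m :: int
  using cong_add_rcancel[of b "- a" c m] by simp

lemma cong_range_imp_eq: "[a = b] (mod int p) \<Longrightarrow> a \<in> {0..<int p} \<Longrightarrow> b \<in> {0..<int p} \<Longrightarrow> a = b"
  by (simp add: cong_def)

lemma injections_cong_imp_eq:
  assumes "x \<in> injections n p" "i \<in> {1..n}" "j \<in> {1..n}" "[x i = x j] (mod int p)"
  shows "i = j"
proof -
  have "x i = x j" using assms by (intro cong_range_imp_eq[of _ _ p]) auto
  moreover have "inj_on x {1..n}" using assms(1) by simp
  ultimately show ?thesis using assms(2,3) inj_on_eq_iff by metis
qed

text \<open>Every equation involves \<open>x 1\<close>, so once \<open>x 1 = a\<close> is chosen, a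
  rook placement prescribes distinct values a - i at its right ends. With \<open>x 1\<close> this
  fixes \<open>card S + 1\<close> coordinates, and the rest is a free injective extension.\<close>

lemma card_Ish_injections:
  assumes n: "n \<ge> 1" "n \<le> p" and S: "\<And>i j. (i, j) \<in> S \<Longrightarrow> 1 \<le> i \<and> i < j \<and> j \<le> n"
  shows "int (card {x \<in> injections n p. \<forall>(i, j)\<in>S. [x 1 - x j = int i] (mod int p)}) =
    (if rook_placement S then int p * (\<Prod>m = card S + 1..n - 1. int p - int m) else 0)"
proof (cases "rook_placement S")
  case False
  have "rook_placement S" if x: "x \<in> injections n p" "\<forall>(i, j)\<in>S. [x 1 - x j = int i] (mod int p)" for x
    unfolding rook_placement_def
  proof (intro conjI inj_onI)
    fix s t assume s: "s \<in> S" "t \<in> S" "fst s = fst t"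
    obtain i j k where ijk: "s = (i, j)" "t = (i, k)" using s(3) by (cases s, cases t) auto
    have "[x 1 - x j = int i] (mod int p)" "[x 1 - x k = int i] (mod int p)" using s ijk x(2) by auto
    then have "[x 1 - x j = x 1 - x k] (mod int p)" by (simp add: cong_def)
    then have "[x j = x k] (mod int p)" by (simp add: cong_diff_lcancel)
    then have "j = k" using S s ijk by (intro injections_cong_imp_eq[OF x(1)]) force+
    then show "s = t" using ijk by simp
  next
    fix s t assume s: "s \<in> S" "t \<in> S" "snd s = snd t"
    obtain i j k where ijk: "s = (j, i)" "t = (k, i)" using s(3) by (cases s, cases t) auto
    have "[x 1 - x i = int j] (mod int p)" "[x 1 - x i = int k] (mod int p)" using s ijk x(2) by auto
    then have "[int j = int k] (mod int p)" by (simp add: cong_def)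
    \<comment> \<open>Left ends are below n <= p, so congruent ones are equal.\<close>
    then have "int j = int k" using S s ijk n by (intro cong_range_imp_eq[of _ _ p]) force+
    then show "s = t" using ijk by simp
  qed
  then have empty: "{x \<in> injections n p. \<forall>(i, j)\<in>S. [x 1 - x j = int i] (mod int p)} = {}"
    using False by blast
  show ?thesis unfolding empty using False by simp
next
  case True
  let ?A = "{x \<in> injections n p. \<forall>(i, j)\<in>S. [x 1 - x j = int i] (mod int p)}"
  let ?J = "insert 1 (snd ` S)"
  have finS: "finite S" by (rule finite_subset[of _ "{1..n} \<times> {1..n}"]) (use S in force)+
  \<comment> \<open>Looks up the pair with a given right end, which is unique in a rook
    placement.\<close>
  define r where "r = the_inv_into S snd"
  have r: "r j = (i, j)" if "(i, j) \<in> S" for i j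
    using True that the_inv_into_f_f[of snd S "(i, j)"] by (simp add: r_def rook_placement_def)
  have S1: "1 \<notin> snd ` S" using S by force
  have cJ: "card ?J = card S + 1"
    using True S1 finS by (simp add: card_image rook_placement_def)
  have fiber: "int (card {x \<in> ?A. x 1 = a}) = (\<Prod>m = card S + 1..n - 1. int p - int m)"
    if a: "a \<in> {0..<int p}" for a
  proof -
    define g where "g j = (if j = 1 then a else (a - int (fst (r j))) mod int p)" for j
    have g: "g j = (a - int i) mod int p" "j \<noteq> 1" if "(i, j) \<in> S" for i j
      using r[OF that] S[OF that] by (auto simp: g_def)
    have g1: "g 1 = a" by (simp add: g_def)
    have iff: "[a - y = int i] (mod int p) \<longleftrightarrow> y = (a - int i) mod int p"
      if y: "y \<in> {0..<int p}" for y i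
    proof
      assume "[a - y = int i] (mod int p)"
      then have "[a - (a - y) = a - int i] (mod int p)" by (intro cong_diff) auto
      then show "y = (a - int i) mod int p" using y by (simp add: cong_def)
    next
      assume "y = (a - int i) mod int p"
      then have "[a - y = a - (a - int i)] (mod int p)" by (intro cong_diff) auto
      then show "[a - y = int i] (mod int p)" by simp
    qed
    have "{x \<in> ?A. x 1 = a} = {f \<in> {1..n} \<rightarrow>\<^sub>E {0..<int p}. inj_on f {1..n} \<and> (\<forall>j\<in>?J. f j = g j)}"
    proof (intro set_eqI iffI)
      fix x assume x: "x \<in> {x \<in> ?A. x 1 = a}"
      have "x j = g j" if ij: "(i, j) \<in> S" for i j
      proof -
        have "x j \<in> {0..<int p}" using x S[OF ij] by auto
        moreover have "[a - x j = int i] (mod int p)" using x ij by auto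
        ultimately show ?thesis using iff g(1)[OF ij] by simp
      qed
      then show "x \<in> {f \<in> {1..n} \<rightarrow>\<^sub>E {0..<int p}. inj_on f {1..n} \<and> (\<forall>j\<in>?J. f j = g j)}"
        using x g1 by auto
    next
      fix x assume x: "x \<in> {f \<in> {1..n} \<rightarrow>\<^sub>E {0..<int p}. inj_on f {1..n} \<and> (\<forall>j\<in>?J. f j = g j)}"
      have x1: "x 1 = a" using x g1 by simp
      have "[x 1 - x j = int i] (mod int p)" if ij: "(i, j) \<in> S" for i j
      proof -
        have "j \<in> ?J" using ij by force
        then have "x j = g j" using x by blast
        then have "x j = (a - int i) mod int p" using g(1)[OF ij] by simp
        moreover have "x j \<in> {0..<int p}" using x S[OF ij] by auto
        ultimately show ?thesis unfolding x1 using iff by blast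
      qed
      then show "x \<in> {x \<in> ?A. x 1 = a}" using x x1 by auto
    qed
    moreover have "int (card {f \<in> {1..n} \<rightarrow>\<^sub>E {0..<int p}. inj_on f {1..n} \<and> (\<forall>j\<in>?J. f j = g j)}) =
        (\<Prod>m = card ?J..<card {1..n}. int (card {0..<int p}) - int m)"
    proof (rule card_inj_extensions)
      show "?J \<subseteq> {1..n}" using n S by force
      show "g ` ?J \<subseteq> {0..<int p}" using a n by (auto simp: g_def)
      have cg: "[int i = int i'] (mod int p)" if "(a - int i) mod int p = (a - int i') mod int p" for i i'
        using that by (metis cong_def cong_diff_lcancel)
      have inS: "inj_on g (snd ` S)"
      proof (rule inj_onI, clarify)
        fix i j i' j' assume s: "(i, j) \<in> S" "(i', j') \<in> S" and "g (snd (i, j)) = g (snd (i', j'))"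
        then have "[int i = int i'] (mod int p)" using g by (intro cg) auto
        then have "int i = int i'" using S[OF s(1)] S[OF s(2)] n by (intro cong_range_imp_eq[of _ _ p]) auto
        then show "snd (i, j) = snd (i', j')"
          using True s by (force simp: rook_placement_def inj_on_def)
      qed
      moreover have "g 1 \<noteq> g j" if j: "j \<in> snd ` S" for j
      proof
        assume eq: "g 1 = g j"
        obtain i where ij: "(i, j) \<in> S" using j by auto
        \<comment> \<open>The coordinate 1 behaves like a right end with left end 0, and real left
          ends lie strictly between 0 and p.\<close>
        have "(a - int 0) mod int p = (a - int i) mod int p" using eq g1 g(1)[OF ij] a by simp
        then have "int 0 = int i" using S[OF ij] n by (intro cong_range_imp_eq[OF cg]) auto
        then show False using S[OF ij] by simp
      qed
      ultimately show "inj_on g ?J" using S1 by (auto simp: inj_on_insert)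
    qed (use n in auto)
    moreover have "{card S + 1..<n} = {card S + 1..n - 1}" using n by auto
    ultimately show ?thesis unfolding cJ by simp
  qed
  have "?A = (\<Union>a\<in>{0..<int p}. {x \<in> ?A. x 1 = a})" using n by (auto simp: PiE_iff)
  then have "card ?A = card (\<Union>a\<in>{0..<int p}. {x \<in> ?A. x 1 = a})" by (rule arg_cong)
  also have "\<dots> = (\<Sum>a\<in>{0..<int p}. card {x \<in> ?A. x 1 = a})"
    by (intro card_UN_disjoint ballI finite_subset[OF _ finite_PiE[of "{1..n}" "\<lambda>_. {0..<int p}"]]) auto
  finally have "int (card ?A) = (\<Sum>a\<in>{0..<int p}. int (card {x \<in> ?A. x 1 = a}))" by simp
  also have "\<dots> = (\<Sum>a\<in>{0..<int p}. \<Prod>m = card S + 1..n - 1. int p - int m)"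
    using fiber by (intro sum.cong) auto
  finally show ?thesis using True by simp
qed

text \<open>Induction on \<open>n\<close>: the largest index \<open>n\<close> is either in no pair, and then takes any of the unused
  values, or lies directly below some \<open>i\<close>, and then its value can be deleted from the range.\<close>

lemma card_linear_injections:
  assumes "n \<ge> 1" "n \<le> p" "\<And>i j. (i, j) \<in> S \<Longrightarrow> 1 \<le> i \<and> i < j \<and> j \<le> n" "rook_placement S"
  shows "int (card {x \<in> injections n p. x 1 = int p - 1 \<and> (\<forall>(i, j)\<in>S. x i = x j + 1)}) =
    (\<Prod>m = card S + 1..<n. int p - int m)"
  using assms
proof (induction n arbitrary: S p rule: nat_induct_at_least)
  case base
  have "S = {}" using base(2) by force
  moreover have "{x \<in> injections 1 p. x 1 = int p - 1} = {\<lambda>k. if k = 1 then int p - 1 else undefined}"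
    using base(1) by (auto simp: PiE_iff extensional_def fun_eq_iff)
  ultimately show ?case by simp
next
  case (Suc n)
  let ?F = "\<lambda>n p S. {x \<in> injections n p. x 1 = int p - 1 \<and> (\<forall>(i, j)\<in>S. x i = x j + 1)}"
  let ?N = "Suc n"
  have finS: "finite S" by (rule finite_subset[of _ "{1..?N} \<times> {1..?N}"]) (use Suc.prems(2) in force)+
  have fin: "finite (?F n p S)" for n p S
    by (rule finite_subset[OF _ finite_PiE[of "{1..n}" "\<lambda>_. {0..<int p}"]]) auto
  have set_N: "{1..?N} = insert ?N {1..n}" by auto
  show ?case
  proof (cases "?N \<in> snd ` S")
    case False
    have S: "1 \<le> i \<and> i < j \<and> j \<le> n" if "(i, j) \<in> S" for i j
      using Suc.prems(2)[OF that] False that by (force simp: le_Suc_eq)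
    have "(\<forall>(i, j)\<in>S. (x(?N := b)) i = (x(?N := b)) j + 1) \<longleftrightarrow> (\<forall>(i, j)\<in>S. x i = x j + 1)"
      for x :: "nat \<Rightarrow> int" and b
    proof (rule ball_cong)
      fix s assume "s \<in> S"
      moreover obtain i j where "s = (i, j)" by (cases s)
      ultimately show "(case s of (i, j) \<Rightarrow> (x(?N := b)) i = (x(?N := b)) j + 1) \<longleftrightarrow>
          (case s of (i, j) \<Rightarrow> x i = x j + 1)"
        using S[of i j] by auto
    qed simp
    then have "card (?F ?N p S) = card (?F n p S) * (p - n)"
      using card_inj_insert[of "{1..n}" "{0..<int p}" ?N
          "\<lambda>x. x 1 = int p - 1 \<and> (\<forall>(i, j)\<in>S. x i = x j + 1)"] Suc.hyps
      unfolding set_N by (simp add: conj_assoc)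
    then have "int (card (?F ?N p S)) = int (card (?F n p S)) * (int p - int n)"
      using Suc.prems(1) by (simp add: of_nat_diff)
    also have "int (card (?F n p S)) = (\<Prod>m = card S + 1..<n. int p - int m)"
      using Suc.prems S by (intro Suc.IH) auto
    also have "(\<Prod>m = card S + 1..<n. int p - int m) * (int p - int n) =
        (\<Prod>m = card S + 1..<Suc n. int p - int m)"
    proof -
      \<comment> \<open>The product gains the factor for \<open>n\<close> only if its range does not
        start beyond \<open>n\<close>; right ends lie in \<open>{2..n}\<close>, which bounds
        \<open>card S\<close>.\<close>
      have "card S = card (snd ` S)"
        using Suc.prems(3) by (simp add: card_image rook_placement_def)
      also have "\<dots> \<le> card {2..n}" using S by (intro card_mono) force+
      finally have "card S + 1 \<le> n" using Suc.hyps by simp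
      then show ?thesis by simp
    qed
    finally show ?thesis .
  next
    case True
    then obtain i where iN: "(i, ?N) \<in> S" by auto
    define S' where "S' = S - {(i, ?N)}"
    have i: "i \<in> {1..n}" using Suc.prems(2)[OF iN] by auto
    \<comment> \<open>By the rook condition \<open>i\<close> is no longer a left end and
      \<open>?N\<close> no longer a right end once their pair is removed.\<close>
    have S': "1 \<le> a \<and> a < b \<and> b \<le> n" "a \<noteq> i" if "(a, b) \<in> S'" for a b
    proof -
      have ab: "(a, b) \<in> S" "(a, b) \<noteq> (i, ?N)" using that by (auto simp: S'_def)
      then show "a \<noteq> i" using Suc.prems(3) iN by (force simp: rook_placement_def inj_on_def)
      have "b \<noteq> ?N" using Suc.prems(3) iN ab by (force simp: rook_placement_def inj_on_def)
      then show "1 \<le> a \<and> a < b \<and> b \<le> n" using Suc.prems(2)[OF ab(1)] by auto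
    qed
    have "p \<ge> 1" using Suc.prems(1) by simp
    then have ip: "int (p - 1) = int p - 1" by (simp add: of_nat_diff)
    \<comment> \<open>\<open>del\<close> removes the value of \<open>?N\<close> and closes the gap.
      As \<open>i\<close> sits one above \<open>?N\<close>, it drops onto the removed value, so
      \<open>ins\<close> can read off from \<open>y i\<close> where to reopen the gap.\<close>
    define del where "del x = (\<lambda>k. if k \<in> {1..n} then (if x k < x ?N then x k else x k - 1) else undefined)"
      for x :: "nat \<Rightarrow> int"
    define ins where "ins y = (\<lambda>k. if k \<in> {1..n} then (if y k < y i then y k else y k + 1)
        else if k = ?N then y i else undefined)" for y :: "nat \<Rightarrow> int"
    have "bij_betw del (?F ?N p S) (?F n (p - 1) S')"
    proof (rule bij_betw_byWitness[where f' = ins])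
      have x_facts: "x i = x ?N + 1" "\<And>k. k \<in> {1..n} \<Longrightarrow> x k \<noteq> x ?N"
        "\<And>a b. (a, b) \<in> S' \<Longrightarrow> x a = x b + 1" "\<And>k. k \<in> {1..?N} \<Longrightarrow> 0 \<le> x k \<and> x k < int p"
        if x: "x \<in> ?F ?N p S" for x
      proof -
        show "x i = x ?N + 1" "\<And>a b. (a, b) \<in> S' \<Longrightarrow> x a = x b + 1"
          using x iN by (auto simp: S'_def)
        show "x k \<noteq> x ?N" if "k \<in> {1..n}" for k
        proof
          assume "x k = x ?N"
          moreover have "inj_on x {1..?N}" using x by simp
          ultimately have "k = ?N" using that by (auto dest: inj_onD)
          then show False using that by simp
        qed
        show "0 \<le> x k \<and> x k < int p" if "k \<in> {1..?N}" for k using x that by auto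
      qed
      show "\<forall>x\<in>?F ?N p S. ins (del x) = x"
      proof
        fix x assume x: "x \<in> ?F ?N p S"
        note f = x_facts[OF x]
        have di: "del x i = x ?N" using f(1) i by (simp add: del_def)
        show "ins (del x) = x"
        proof
          fix k
          consider "k \<in> {1..n}" | "k = ?N" | "k \<notin> {1..?N}" by fastforce
          then show "ins (del x) k = x k"
          proof cases
            case 1
            have "del x k = (if x k < x ?N then x k else x k - 1)" using 1 by (simp add: del_def)
            then show ?thesis using f(2)[OF 1] 1 di by (simp add: ins_def)
          next
            case 2
            then show ?thesis using di by (simp add: ins_def)
          next
            case 3
            then show ?thesis using x by (auto simp: ins_def PiE_iff extensional_def)
          qed
        qed
      qed
      show "\<forall>y\<in>?F n (p - 1) S'. del (ins y) = y"
      proof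
        fix y assume y: "y \<in> ?F n (p - 1) S'"
        have "ins y ?N = y i" by (simp add: ins_def)
        then show "del (ins y) = y" using y by (auto simp: del_def ins_def PiE_iff extensional_def fun_eq_iff)
      qed
      show "del ` ?F ?N p S \<subseteq> ?F n (p - 1) S'"
      proof
        fix y assume "y \<in> del ` ?F ?N p S"
        then obtain x where y: "y = del x" and x: "x \<in> ?F ?N p S" by blast
        note f = x_facts[OF x]
        have d: "del x k = (if x k < x ?N then x k else x k - 1)" if "k \<in> {1..n}" for k
          using that by (simp add: del_def)
        have x1: "x 1 = int p - 1" using x by simp
        \<comment> \<open>The removed value lies below the top, so the value of 1 drops with the
          range and is again the top one.\<close>
        have lt: "x ?N < int p - 1" using f(4)[of i] f(1) i by simp
        have r: "0 \<le> del x k \<and> del x k < int (p - 1)" if k: "k \<in> {1..n}" for k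
          using d[OF k] f(2)[OF k] f(4)[of k] f(4)[of ?N] k lt ip by auto
        have "del x \<in> {1..n} \<rightarrow>\<^sub>E {0..<int (p - 1)}"
          using r by (auto simp: PiE_iff extensional_def) (auto simp: del_def)
        moreover have "inj_on (del x) {1..n}"
        proof (rule inj_onI)
          fix k l assume kl: "k \<in> {1..n}" "l \<in> {1..n}" "del x k = del x l"
          then have "x k = x l" using d[OF kl(1)] d[OF kl(2)] f(2)[OF kl(1)] f(2)[OF kl(2)]
            by (auto split: if_splits)
          moreover have "inj_on x {1..?N}" using x by simp
          ultimately show "k = l" using kl by (auto dest: inj_onD)
        qed
        moreover have "del x 1 = int (p - 1) - 1" using d[of 1] x1 lt ip Suc.hyps by simp
        moreover have "del x a = del x b + 1" if ab: "(a, b) \<in> S'" for a b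
        proof -
          have "a \<in> {1..n}" "b \<in> {1..n}" using S'[OF ab] by auto
          \<comment> \<open>Neither of the consecutive values of \<open>a\<close> and
            \<open>b\<close> is the removed one, so both lie on the same side of it and stay
            consecutive.\<close>
          then show ?thesis using d f(2)[of a] f(2)[of b] f(3)[OF ab] by auto
        qed
        ultimately show "y \<in> ?F n (p - 1) S'" using y by auto
      qed
      show "ins ` ?F n (p - 1) S' \<subseteq> ?F ?N p S"
      proof
        fix x assume "x \<in> ins ` ?F n (p - 1) S'"
        then obtain y where x: "x = ins y" and y: "y \<in> ?F n (p - 1) S'" by blast
        have d: "ins y k = (if y k < y i then y k else y k + 1)" if "k \<in> {1..n}" for k
          using that by (simp add: ins_def)
        have dN: "ins y ?N = y i" by (simp add: ins_def)
        have yr: "0 \<le> y k \<and> y k < int p - 1" if k: "k \<in> {1..n}" for k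
          using y k ip by auto
        have yinj: "k = l" if "k \<in> {1..n}" "l \<in> {1..n}" "y k = y l" for k l
          using y that by (auto dest: inj_onD)
        have r: "0 \<le> ins y k \<and> ins y k < int p" if k: "k \<in> {1..?N}" for k
        proof (cases "k = ?N")
          case True
          then show ?thesis using dN yr[OF i] by simp
        next
          case False
          then have "k \<in> {1..n}" using k by auto
          then show ?thesis using d[of k] yr[of k] by simp
        qed
        have "ins y \<in> {1..?N} \<rightarrow>\<^sub>E {0..<int p}"
          using r by (auto simp: PiE_iff extensional_def) (auto simp: ins_def)
        moreover have "inj_on (ins y) {1..?N}"
        proof -
          have "inj_on (ins y) {1..n}"
          proof (rule inj_onI)
            fix k l assume kl: "k \<in> {1..n}" "l \<in> {1..n}" "ins y k = ins y l"
            then have "y k = y l" using d[OF kl(1)] d[OF kl(2)] by (auto split: if_splits)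
            then show "k = l" using yinj kl by blast
          qed
          moreover have "ins y ?N \<noteq> ins y k" if "k \<in> {1..n}" for k using d[OF that] dN by auto
          then have "ins y ?N \<notin> ins y ` {1..n}" by blast
          ultimately show ?thesis unfolding set_N by (simp add: inj_on_insert)
        qed
        moreover have "ins y 1 = int p - 1"
        proof -
          have "y 1 = int p - 2" using y ip by simp
          then show ?thesis using d[of 1] yr[OF i] Suc.hyps by simp
        qed
        moreover have "ins y a = ins y b + 1" if ab: "(a, b) \<in> S" for a b
        proof (cases "(a, b) = (i, ?N)")
          case True
          then show ?thesis using d[OF i] dN by simp
        next
          case False
          then have ab': "(a, b) \<in> S'" using ab by (simp add: S'_def)
          have m: "a \<in> {1..n}" "b \<in> {1..n}" using S'[OF ab'] by auto
          have "y a = y b + 1" using y ab' by auto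
          \<comment> \<open>Reopening the gap separates consecutive values only if the upper one is
            \<open>y i\<close>, and \<open>i\<close> is not the left end of another pair.\<close>
          moreover have "y a \<noteq> y i" using yinj[OF m(1) i] S'(2)[OF ab'] by blast
          ultimately show ?thesis using d m by auto
        qed
        ultimately show "x \<in> ?F ?N p S" using x by auto
      qed
    qed
    then have "card (?F ?N p S) = card (?F n (p - 1) S')" by (rule bij_betw_same_card)
    then have "int (card (?F ?N p S)) = int (card (?F n (p - 1) S'))" by (rule arg_cong)
    also have "\<dots> = (\<Prod>m = card S' + 1..<n. int (p - 1) - int m)"
      using Suc.prems S'(1)
      by (intro Suc.IH) (auto simp: S'_def rook_placement_def intro: inj_on_diff)
    also have "\<dots> = (\<Prod>m = card S..<n. int p - int (Suc m))"
    proof -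
      have "card S' + 1 = card S" unfolding S'_def using card_Suc_Diff1[OF finS iN] by linarith
      then show ?thesis using ip by (intro prod.cong) auto
    qed
    also have "\<dots> = (\<Prod>m = card S + 1..<?N. int p - int m)"
      by (simp only: prod.shift_bounds_Suc_ivl Suc_eq_plus1[symmetric])
    finally show ?thesis .
  qed
qed

text \<open>All conditions concern differences modulo p, so rotation makes the p fibres over the
  values of \<open>x 1\<close> equally large. The fibre over p - 1 has no wrap-around and is the
  linear count.\<close>

lemma card_Shi_injections:
  assumes n: "n \<ge> 1" "n \<le> p" and S: "\<And>i j. (i, j) \<in> S \<Longrightarrow> 1 \<le> i \<and> i < j \<and> j \<le> n"
  shows "int (card {x \<in> injections n p. \<forall>(i, j)\<in>S. [x i - x j = 1] (mod int p)}) =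
    (if rook_placement S then int p * (\<Prod>m = card S + 1..n - 1. int p - int m) else 0)"
proof (cases "rook_placement S")
  case False
  have "rook_placement S" if x: "x \<in> injections n p" "\<forall>(i, j)\<in>S. [x i - x j = 1] (mod int p)" for x
    unfolding rook_placement_def
  proof (intro conjI inj_onI)
    fix s t assume s: "s \<in> S" "t \<in> S" "fst s = fst t"
    obtain i j k where ijk: "s = (i, j)" "t = (i, k)" using s(3) by (cases s, cases t) auto
    have "[x i - x j = 1] (mod int p)" "[x i - x k = 1] (mod int p)" using s ijk x(2) by auto
    then have "[x i - x j = x i - x k] (mod int p)" by (simp add: cong_def)
    then have "[x j = x k] (mod int p)" by (simp add: cong_diff_lcancel)
    then have "j = k" using S s ijk by (intro injections_cong_imp_eq[OF x(1)]) force+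
    then show "s = t" using ijk by simp
  next
    fix s t assume s: "s \<in> S" "t \<in> S" "snd s = snd t"
    obtain i j k where ijk: "s = (j, i)" "t = (k, i)" using s(3) by (cases s, cases t) auto
    have "[x j - x i = 1] (mod int p)" "[x k - x i = 1] (mod int p)" using s ijk x(2) by auto
    then have "[x j - x i = x k - x i] (mod int p)" by (simp add: cong_def)
    then have "[x j = x k] (mod int p)" by (simp add: cong_diff_rcancel)
    then have "j = k" using S s ijk by (intro injections_cong_imp_eq[OF x(1)]) force+
    then show "s = t" using ijk by simp
  qed
  then have empty: "{x \<in> injections n p. \<forall>(i, j)\<in>S. [x i - x j = 1] (mod int p)} = {}"
    using False by blast
  show ?thesis unfolding empty using False by simp
next
  case True
  let ?A = "{x \<in> injections n p. \<forall>(i, j)\<in>S. [x i - x j = 1] (mod int p)}"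
  let ?L = "{x \<in> injections n p. x 1 = int p - 1 \<and> (\<forall>(i, j)\<in>S. x i = x j + 1)}"
  have p: "p > 0" using n by simp
  \<comment> \<open>Since \<open>1\<close> occupies the top value \<open>p - 1\<close> and is never the lower end of a pair, no pair wraps around.\<close>
  have L: "?L = {x \<in> ?A. x 1 = int p - 1}"
  proof (intro set_eqI iffI)
    fix x assume x: "x \<in> {x \<in> ?A. x 1 = int p - 1}"
    have "x i = x j + 1" if ij: "(i, j) \<in> S" for i j
    proof -
      have m: "i \<in> {1..n}" "j \<in> {1..n}" "j \<noteq> 1" using S[OF ij] by auto
      have "inj_on x {1..n}" using x by simp
      then have "x j \<noteq> x 1" using inj_on_eq_iff[of x "{1..n}" j 1] m n by simp
      moreover have r: "x i \<in> {0..<int p}" "x j \<in> {0..<int p}" using x m by auto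
      ultimately have "x j + 1 \<in> {0..<int p}" using x by auto
      moreover have "[x i - x j = 1] (mod int p)" using x ij by auto
      then have "[x i - x j + x j = 1 + x j] (mod int p)" by (simp only: cong_add_rcancel)
      then have "[x i = x j + 1] (mod int p)" by (simp add: add.commute)
      ultimately show ?thesis using r by (intro cong_range_imp_eq[of _ _ p]) auto
    qed
    then show "x \<in> ?L" using x by auto
  qed auto
  define h where "h s x = (\<lambda>k. if k \<in> {1..n} then (x k + s) mod int p else undefined)"
    for s :: int and x :: "nat \<Rightarrow> int"
  have hA: "h s x \<in> ?A" if x: "x \<in> ?A" for s x
  proof -
    have c: "[h s x k - h s x l = x k - x l] (mod int p)" if "k \<in> {1..n}" "l \<in> {1..n}" for k l
      using that by (simp add: h_def cong_def mod_diff_eq)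
    have "h s x \<in> {1..n} \<rightarrow>\<^sub>E {0..<int p}" using p by (auto simp: h_def)
    moreover have "inj_on (h s x) {1..n}"
    proof (rule inj_onI)
      fix k l assume kl: "k \<in> {1..n}" "l \<in> {1..n}" "h s x k = h s x l"
      then have "[x k - x l = 0] (mod int p)" using c[OF kl(1,2)] by (simp add: cong_sym_eq)
      then have "[x k = x l] (mod int p)" by (simp add: cong_diff_iff_cong_0)
      then show "k = l" using x kl by (intro injections_cong_imp_eq[of x n p]) auto
    qed
    moreover have "[h s x i - h s x j = 1] (mod int p)" if ij: "(i, j) \<in> S" for i j
    proof -
      have "[x i - x j = 1] (mod int p)" using x ij by auto
      then show ?thesis using c[of i j] S[OF ij] cong_trans by auto
    qed
    ultimately show ?thesis by auto
  qed
  have hh: "h (- s) (h s x) = x" if x: "x \<in> ?A" for s x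
  proof
    fix k
    have "x \<in> {1..n} \<rightarrow>\<^sub>E {0..<int p}" using x by simp
    then show "h (- s) (h s x) k = x k"
      by (cases "k \<in> {1..n}") (auto simp: h_def mod_simps PiE_iff extensional_def)
  qed
  have h1: "h s x 1 = (x 1 + s) mod int p" for s x using n by (simp add: h_def)
  have fiber: "card {x \<in> ?A. x 1 = a} = card ?L" if a: "a \<in> {0..<int p}" for a
  proof -
    have neg: "- 1 - a = - (a + 1)" by simp
    \<comment> \<open>The shift by -1 - a sends \<open>a\<close> to -1, which is p - 1 modulo
      p.\<close>
    have "bij_betw (h (- 1 - a)) {x \<in> ?A. x 1 = a} {x \<in> ?A. x 1 = int p - 1}"
    proof (rule bij_betw_byWitness[where f' = "h (a + 1)"])
      show "\<forall>x\<in>{x \<in> ?A. x 1 = a}. h (a + 1) (h (- 1 - a) x) = x" using hh[of _ "- 1 - a"] by simp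
      show "\<forall>x\<in>{x \<in> ?A. x 1 = int p - 1}. h (- 1 - a) (h (a + 1) x) = x"
        unfolding neg using hh[of _ "a + 1"] by blast
      have "(- 1) mod int p = int p - 1" using p by (simp add: zmod_minus1)
      then show "h (- 1 - a) ` {x \<in> ?A. x 1 = a} \<subseteq> {x \<in> ?A. x 1 = int p - 1}"
        using hA[of _ "- 1 - a"] h1 by auto
      have "(int p + a) mod int p = a" using a by simp
      then show "h (a + 1) ` {x \<in> ?A. x 1 = int p - 1} \<subseteq> {x \<in> ?A. x 1 = a}"
        using hA[of _ "a + 1"] h1 by auto
    qed
    then show ?thesis unfolding L by (rule bij_betw_same_card)
  qed
  have "?A = (\<Union>a\<in>{0..<int p}. {x \<in> ?A. x 1 = a})" using n by (auto simp: PiE_iff)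
  then have "card ?A = card (\<Union>a\<in>{0..<int p}. {x \<in> ?A. x 1 = a})" by (rule arg_cong)
  also have "\<dots> = (\<Sum>a\<in>{0..<int p}. card {x \<in> ?A. x 1 = a})"
    by (intro card_UN_disjoint ballI finite_subset[OF _ finite_PiE[of "{1..n}" "\<lambda>_. {0..<int p}"]]) auto
  also have "\<dots> = p * card ?L" using fiber by simp
  finally have "int (card ?A) = int p * int (card ?L)" by simp
  also have "int (card ?L) = (\<Prod>m = card S + 1..<n. int p - int m)"
    using n S True by (rule card_linear_injections)
  also have "{card S + 1..<n} = {card S + 1..n - 1}" using n by auto
  finally show ?thesis using True by simp
qed

section \<open>The characteristic polynomials\<close>

text \<open>Grouping the placements by size \<open>k\<close> turns their number into a Stirling
  number; sizes stop at n - 1 because the distinct right ends lie in \<open>{2..n}\<close>.\<close>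

lemma sum_rook_placements_eq_Stir:
  fixes q :: int
  assumes n: "n \<ge> 1" and G: "G \<subseteq> {E. E \<subseteq> {1..n} \<and> card E = 2}"
  shows "(\<Sum>S\<in>Pow {(i, j). i < j \<and> {i, j} \<in> G}. (-1) ^ card S *
      (if rook_placement S then q * (\<Prod>m = card S + 1..n - 1. q - int m) else 0)) =
    q * (\<Sum>k = 0..n - 1. (-1) ^ k * int (Stir n G (n - k)) * (\<Prod>m = k + 1..n - 1. q - int m))"
proof -
  let ?D = "{(i, j). i < j \<and> {i, j} \<in> G}"
  let ?w = "\<lambda>k. (-1) ^ k * (q * (\<Prod>m = k + 1..n - 1. q - int m))"
  have D: "1 \<le> i \<and> i < j \<and> j \<le> n" if "(i, j) \<in> ?D" for i j
    using that G by force
  have fin: "finite ?D" by (rule finite_subset[of _ "{1..n} \<times> {1..n}"]) (use D in force)+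
  have le: "card S \<in> {0..n - 1}" if S: "S \<subseteq> ?D" "rook_placement S" for S
  proof -
    have "card S = card (snd ` S)" using S(2) by (simp add: card_image rook_placement_def)
    also have "\<dots> \<le> card {2..n}" using D S(1) by (intro card_mono) force+
    finally show ?thesis by simp
  qed
  have "(\<Sum>S\<in>Pow ?D. (-1) ^ card S *
      (if rook_placement S then q * (\<Prod>m = card S + 1..n - 1. q - int m) else 0)) =
      (\<Sum>S\<in>{S \<in> Pow ?D. rook_placement S}. ?w (card S))"
    using fin by (intro sum.mono_neutral_cong_right) auto
  also have "\<dots> = (\<Sum>k\<in>{0..n - 1}. \<Sum>S\<in>{S \<in> {S \<in> Pow ?D. rook_placement S}. card S = k}. ?w (card S))"
    using fin le by (intro sum.group[symmetric]) auto
  also have "\<dots> = (\<Sum>k = 0..n - 1. int (Stir n G (n - k)) * ?w k)"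
  proof (rule sum.cong)
    fix k assume "k \<in> {0..n - 1}"
    then have "Stir n G (n - k) = card {S. S \<subseteq> ?D \<and> rook_placement S \<and> card S = k}"
      using n by (intro Stir_eq_card_rook_placements[OF G]) auto
    moreover have "{S \<in> {S \<in> Pow ?D. rook_placement S}. card S = k} =
        {S. S \<subseteq> ?D \<and> rook_placement S \<and> card S = k}" by auto
    ultimately show "(\<Sum>S\<in>{S \<in> {S \<in> Pow ?D. rook_placement S}. card S = k}. ?w (card S)) =
        int (Stir n G (n - k)) * ?w k" by simp
  qed simp
  also have "\<dots> = q * (\<Sum>k = 0..n - 1. (-1) ^ k * int (Stir n G (n - k)) * (\<Prod>m = k + 1..n - 1. q - int m))"
    by (simp add: sum_distrib_left mult_ac)
  finally show ?thesis .
qed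

lemma poly_eqI_eventually:
  fixes f g :: "int poly"
  assumes "\<forall>\<^sub>F p in sequentially. poly f (int p) = poly g (int p)"
  shows "f = g"
proof (rule ccontr)
  assume "f \<noteq> g"
  then have "finite {x. poly (f - g) x = 0}" by (intro poly_roots_finite) simp
  moreover obtain N where N: "\<And>p. p \<ge> N \<Longrightarrow> poly f (int p) = poly g (int p)"
    using assms by (auto simp: eventually_sequentially)
  then have "int ` {N..} \<subseteq> {x. poly (f - g) x = 0}" by auto
  ultimately have "finite (int ` {N..})" by (rule finite_subset[rotated])
  then have "finite {N..}" by (rule finite_imageD) simp
  then show False using infinite_Ici by blast
qed

text \<open>\<open>Q\<close> translates an edge into its equation, so that Shi and Ish become two
  instances which differ only in how \<open>count\<close> is established.\<close>

lemma chi_poly_eq_Stir_sum: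
  fixes e :: "nat \<Rightarrow> 'n::finite" and Q :: "nat \<times> nat \<Rightarrow> nat \<times> nat \<times> int"
  assumes n: "n \<ge> 1" and e: "bij_betw e {1..n} (UNIV :: 'n set)"
    and G: "G \<subseteq> {E. E \<subseteq> {1..n} \<and> card E = 2}"
    and Q: "\<And>i j a b c. 1 \<le> i \<Longrightarrow> i < j \<Longrightarrow> j \<le> n \<Longrightarrow> Q (i, j) = (a, b, c) \<Longrightarrow> 1 \<le> a \<and> a < b \<and> b \<le> n"
    and count: "\<And>p S. n \<le> p \<Longrightarrow> (\<And>i j. (i, j) \<in> S \<Longrightarrow> 1 \<le> i \<and> i < j \<and> j \<le> n) \<Longrightarrow>
      int (card {x \<in> injections n p. \<forall>s\<in>S. case Q s of (a, b, c) \<Rightarrow> [x a - x b = c] (mod int p)}) =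
      (if rook_placement S then int p * (\<Prod>m = card S + 1..n - 1. int p - int m) else 0)"
  shows "chi_poly (diff_hyperplane e `
      ({(i, j, 0) | i j. 1 \<le> i \<and> i < j \<and> j \<le> n} \<union> Q ` {(i, j). i < j \<and> {i, j} \<in> G})) =
    [:0, 1:] * (\<Sum>k = 0..n - 1. (-1) ^ k * of_nat (Stir n G (n - k)) * (\<Prod>m = k + 1..n - 1. [:- int m, 1:]))"
proof (rule poly_eqI_eventually)
  let ?D = "{(i, j). i < j \<and> {i, j} \<in> G}"
  let ?K = "{(i, j, 0::int) | i j. 1 \<le> i \<and> i < j \<and> j \<le> n}"
  let ?T = "?K \<union> Q ` ?D"
  have D: "1 \<le> i \<and> i < j \<and> j \<le> n" if "(i, j) \<in> ?D" for i j
    using that G by force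
  have finD: "finite ?D" by (rule finite_subset[of _ "{1..n} \<times> {1..n}"]) (use D in force)+
  have finK: "finite ?K" by (rule finite_subset[of _ "{1..n} \<times> {1..n} \<times> {0}"]) auto
  have T: "1 \<le> a \<and> a < b \<and> b \<le> n" if t: "(a, b, c) \<in> ?T" for a b c
  proof (cases "(a, b, c) \<in> ?K")
    case False
    then obtain i j where ij: "(i, j) \<in> ?D" "Q (i, j) = (a, b, c)" using t by auto
    then show ?thesis using Q D[OF ij(1)] by blast
  qed auto
  have "\<forall>\<^sub>F p in sequentially. poly (chi_poly (diff_hyperplane e ` ?T)) (int p) =
    int (card {x \<in> {1..n} \<rightarrow>\<^sub>E {0..<int p}. \<forall>(i, j, c)\<in>?T. \<not> [x i - x j = c] (mod int p)})"
    using e _ T by (rule poly_chi_poly_eq_card) (use finD finK in simp)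
  then show "\<forall>\<^sub>F p in sequentially. poly (chi_poly (diff_hyperplane e ` ?T)) (int p) =
    poly ([:0, 1:] * (\<Sum>k = 0..n - 1. (-1) ^ k * of_nat (Stir n G (n - k)) *
      (\<Prod>m = k + 1..n - 1. [:- int m, 1:]))) (int p)"
    using eventually_ge_at_top[of n]
  proof eventually_elim
    case (elim p)
    have "{x \<in> {1..n} \<rightarrow>\<^sub>E {0..<int p}. \<forall>(i, j, c)\<in>?T. \<not> [x i - x j = c] (mod int p)} =
      {x \<in> injections n p. \<forall>s\<in>?D. \<not> (case Q s of (a, b, c) \<Rightarrow> [x a - x b = c] (mod int p))}"
    proof -
      \<comment> \<open>Values in \<open>{0..<int p}\<close> are congruent only if equal, so
        avoiding the braid hyperplanes modulo p is injectivity.\<close>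
      have braid: "(\<forall>(i, j, c)\<in>?K. \<not> [x i - x j = c] (mod int p)) \<longleftrightarrow> inj_on x {1..n}"
        if x: "x \<in> {1..n} \<rightarrow>\<^sub>E {0..<int p}" for x
      proof -
        have "[x i - x j = 0] (mod int p) \<longleftrightarrow> x i = x j" if "i \<in> {1..n}" "j \<in> {1..n}" for i j
        proof -
          have "x i \<in> {0..<int p}" "x j \<in> {0..<int p}" using x that by auto
          then show ?thesis using cong_range_imp_eq[of "x i" "x j" p] by (auto simp: cong_diff_iff_cong_0)
        qed
        then have "(\<forall>(i, j, c)\<in>?K. \<not> [x i - x j = c] (mod int p)) \<longleftrightarrow>
            (\<forall>i j. 1 \<le> i \<and> i < j \<and> j \<le> n \<longrightarrow> x i \<noteq> x j)"
          by fastforce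
        also have "\<dots> \<longleftrightarrow> inj_on x {1..n}"
          by (auto intro!: linorder_inj_onI' dest: inj_onD)
        finally show ?thesis .
      qed
      have split: "(\<forall>(i, j, c)\<in>?T. \<not> [x i - x j = c] (mod int p)) \<longleftrightarrow>
          (\<forall>(i, j, c)\<in>?K. \<not> [x i - x j = c] (mod int p)) \<and>
          (\<forall>s\<in>?D. \<not> (case Q s of (a, b, c) \<Rightarrow> [x a - x b = c] (mod int p)))" for x
        unfolding ball_Un ball_simps by (simp only: case_prod_unfold)
      show ?thesis
      proof (rule set_eqI)
        fix x
        show "x \<in> {x \<in> {1..n} \<rightarrow>\<^sub>E {0..<int p}. \<forall>(i, j, c)\<in>?T. \<not> [x i - x j = c] (mod int p)} \<longleftrightarrow>
          x \<in> {x \<in> injections n p. \<forall>s\<in>?D. \<not> (case Q s of (a, b, c) \<Rightarrow> [x a - x b = c] (mod int p))}"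
          unfolding mem_Collect_eq split conj_assoc by (intro conj_cong refl braid)
      qed
    qed
    then have "poly (chi_poly (diff_hyperplane e ` ?T)) (int p) =
      int (card {x \<in> injections n p. \<forall>s\<in>?D. \<not> (case Q s of (a, b, c) \<Rightarrow> [x a - x b = c] (mod int p))})"
      using elim(1) by (simp only:)
    \<comment> \<open>Inclusion-exclusion is indexed by the edges themselves and not by their
      triples, so that \<open>S\<close> is an edge set to which the rook condition applies.\<close>
    also have "\<dots> = (\<Sum>S\<in>Pow ?D. (-1) ^ card S * int (card {x \<in> injections n p.
        \<forall>s\<in>S. case Q s of (a, b, c) \<Rightarrow> [x a - x b = c] (mod int p)}))"
      using finD by (intro card_avoiding_all finite_subset[OF _ finite_PiE[of "{1..n}" "\<lambda>_. {0..<int p}"]]) auto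
    also have "\<dots> = (\<Sum>S\<in>Pow ?D. (-1) ^ card S *
        (if rook_placement S then int p * (\<Prod>m = card S + 1..n - 1. int p - int m) else 0))"
    proof (rule sum.cong)
      fix S assume "S \<in> Pow ?D"
      then have "1 \<le> i \<and> i < j \<and> j \<le> n" if "(i, j) \<in> S" for i j using D that by blast
      then show "(-1) ^ card S * int (card {x \<in> injections n p.
          \<forall>s\<in>S. case Q s of (a, b, c) \<Rightarrow> [x a - x b = c] (mod int p)}) = (-1) ^ card S *
          (if rook_placement S then int p * (\<Prod>m = card S + 1..n - 1. int p - int m) else 0)"
        by (subst count[OF elim(2)]) auto
    qed simp
    also have "\<dots> = int p * (\<Sum>k = 0..n - 1. (-1) ^ k * int (Stir n G (n - k)) *
        (\<Prod>m = k + 1..n - 1. int p - int m))"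
      using n G by (rule sum_rook_placements_eq_Stir)
    finally show ?case by (simp add: poly_sum poly_prod)
  qed
qed

theorem theorem3p2:
  fixes n :: nat and G :: "nat set set" and e :: "nat \<Rightarrow> 'n::finite"
  assumes "n \<ge> 1"
    and "bij_betw e {1..n} (UNIV :: 'n set)"
    and "G \<subseteq> {E. E \<subseteq> {1..n} \<and> card E = 2}"
  shows "chi_poly (Shi n e G) = chi_poly (Ish n e G) \<and>
    chi_poly (Ish n e G) =
      [:0, 1:] * (\<Sum>k = 0..n - 1. (-1) ^ k * of_nat (Stir n G (n - k)) *
                    (\<Prod>m = k + 1..n - 1. [:- int m, 1:]))"
proof -
  let ?D = "{(i, j). i < j \<and> {i, j} \<in> G}"
  let ?K = "{(i, j, 0::int) | i j. 1 \<le> i \<and> i < j \<and> j \<le> n}"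
  have braid: "{{x. x $ e i - x $ e j = 0} | i j. 1 \<le> i \<and> i < j \<and> j \<le> n} = diff_hyperplane e ` ?K"
    by (force simp: diff_hyperplane_def)
  have "Shi n e G = diff_hyperplane e ` (?K \<union> (\<lambda>(i, j). (i, j, 1)) ` ?D)"
    unfolding Shi_def image_Un braid by (intro arg_cong2[where f = "(\<union>)"]) (force simp: diff_hyperplane_def)+
  moreover have "Ish n e G = diff_hyperplane e ` (?K \<union> (\<lambda>(i, j). (1, j, int i)) ` ?D)"
    unfolding Ish_def image_Un braid by (intro arg_cong2[where f = "(\<union>)"]) (force simp: diff_hyperplane_def)+
  moreover have "chi_poly (diff_hyperplane e ` (?K \<union> (\<lambda>(i, j). (i, j, 1)) ` ?D)) =
      [:0, 1:] * (\<Sum>k = 0..n - 1. (-1) ^ k * of_nat (Stir n G (n - k)) * (\<Prod>m = k + 1..n - 1. [:- int m, 1:]))"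
  proof (rule chi_poly_eq_Stir_sum[OF assms])
    fix p :: nat and S :: "(nat \<times> nat) set"
    assume "n \<le> p" "\<And>i j. (i, j) \<in> S \<Longrightarrow> 1 \<le> i \<and> i < j \<and> j \<le> n"
    from card_Shi_injections[OF assms(1) this]
    show "int (card {x \<in> injections n p. \<forall>s\<in>S. case (case s of (i, j) \<Rightarrow> (i, j, 1)) of
        (a, b, c) \<Rightarrow> [x a - x b = c] (mod int p)}) =
      (if rook_placement S then int p * (\<Prod>m = card S + 1..n - 1. int p - int m) else 0)"
      by (simp add: case_prod_unfold)
  qed auto
  moreover have "chi_poly (diff_hyperplane e ` (?K \<union> (\<lambda>(i, j). (1, j, int i)) ` ?D)) =
      [:0, 1:] * (\<Sum>k = 0..n - 1. (-1) ^ k * of_nat (Stir n G (n - k)) * (\<Prod>m = k + 1..n - 1. [:- int m, 1:]))"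
  proof (rule chi_poly_eq_Stir_sum[OF assms])
    fix p :: nat and S :: "(nat \<times> nat) set"
    assume "n \<le> p" "\<And>i j. (i, j) \<in> S \<Longrightarrow> 1 \<le> i \<and> i < j \<and> j \<le> n"
    from card_Ish_injections[OF assms(1) this]
    show "int (card {x \<in> injections n p. \<forall>s\<in>S. case (case s of (i, j) \<Rightarrow> (1, j, int i)) of
        (a, b, c) \<Rightarrow> [x a - x b = c] (mod int p)}) =
      (if rook_placement S then int p * (\<Prod>m = card S + 1..n - 1. int p - int m) else 0)"
      by (simp add: case_prod_unfold)
  qed auto
  ultimately show ?thesis by simp
qed

end
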